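(* Let $k\ge 3$ and let $\ell$ be an integer satisfying $k/2<\ell<k$. Then for every rational number $\alpha\in[0,1)$ there exists a finite (nonempty) family $\mathcal F$ of $k$-graphs such that $\gamma^{(k)}_\ell(\mathcal F)=\alpha$.
   Context: A $k$-graph is a pair $H=(V,E)$ with $V$ a finite set and $E\subseteq\binom{V}{k}$. For $0<\ell<k$ and $T\in\binom{V(H)}{\ell}$, the degree $d_H(T)$ is the number of $(k-\ell)$-sets $T'\subseteq V(H)\setminus T$ with $T\cup T'\in E(H)$; the minimum $\ell$-degree is $\delta_\ell(H)=\min\{d_H(T):T\in\binom{V(H)}{\ell}\}$. For a nonempty family $\mathcal F$ of $k$-graphs, each having at least one edge, a $k$-graph is $\mathcal F$-free if it contains no member of $\mathcal F$ as a (not necessarily induced) subgraph. Let $\mathrm{ex}^{(k)}_\ell(n,\mathcal F)$ be the maximum of $\delta_\ell(H)$ over all $n$-vertex $\mathcal F$-free $k$-graphs $H$. The $\ell$-degree Turán density is \[\gamma^{(k)}_\ell(\mathcal F)=\lim_{n\to\infty}\frac{\mathrm{ex}^{(k)}_\ell(n,\mathcal F)}{\binom{n-\ell}{k-\ell}},\] and this limit is known to exist. *)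

theory Defs
  imports Complex_Main "HOL-Library.Ramsey"
begin

type_synonym 'a hypergraph = "'a set \<times> 'a set set"

abbreviation verts :: "'a hypergraph \<Rightarrow> 'a set" where
  "verts H \<equiv> fst H"

abbreviation edges :: "'a hypergraph \<Rightarrow> 'a set set" where
  "edges H \<equiv> snd H"

definition k_graph :: "nat \<Rightarrow> 'a hypergraph \<Rightarrow> bool" where
  "k_graph k H \<longleftrightarrow> finite (verts H) \<and> edges H \<subseteq> nsets (verts H) k"

definition degree :: "nat \<Rightarrow> 'a hypergraph \<Rightarrow> 'a set \<Rightarrow> nat" where
  "degree k H T = card {T' \<in> nsets (verts H - T) (k - card T). T \<union> T' \<in> edges H}"

text \<open>The minimum is over a nonempty set exactly when \<open>H\<close> has at least \<open>l\<close> vertices;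
  otherwise the value is unspecified, which does not affect limits in the number of vertices.\<close>

definition min_degree :: "nat \<Rightarrow> nat \<Rightarrow> 'a hypergraph \<Rightarrow> nat" where
  "min_degree k l H = Min (degree k H ` nsets (verts H) l)"

text \<open>Containment as a subgraph is understood up to isomorphism, hence the injection.\<close>

definition contains :: "'a hypergraph \<Rightarrow> 'b hypergraph \<Rightarrow> bool" where
  "contains H F \<longleftrightarrow>
     (\<exists>f. inj_on f (verts F) \<and> f ` verts F \<subseteq> verts H \<and> (\<forall>e\<in>edges F. f ` e \<in> edges H))"

definition family_free :: "'b hypergraph set \<Rightarrow> 'a hypergraph \<Rightarrow> bool" where
  "family_free \<F> H \<longleftrightarrow> (\<forall>F\<in>\<F>. \<not> contains H F)"

text \<open>Vertices of the host graphs are natural numbers; every finite hypergraph is isomorphic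
  to such a graph. The set of values below is finite although the set of graphs is not.\<close>

definition ex_degree :: "nat \<Rightarrow> nat \<Rightarrow> nat \<Rightarrow> 'b hypergraph set \<Rightarrow> nat" where
  "ex_degree k l n \<F> =
     Max {min_degree k l H | H :: nat hypergraph.
            k_graph k H \<and> card (verts H) = n \<and> family_free \<F> H}"

definition ex_ratio :: "nat \<Rightarrow> nat \<Rightarrow> 'b hypergraph set \<Rightarrow> nat \<Rightarrow> real" where
  "ex_ratio k l \<F> n = real (ex_degree k l n \<F>) / real ((n - l) choose (k - l))"

definition turan_density :: "nat \<Rightarrow> nat \<Rightarrow> 'b hypergraph set \<Rightarrow> real" where
  "turan_density k l \<F> = lim (ex_ratio k l \<F>)"

end

theory Submission
  imports Defs "HOL-Library.FuncSet" "HOL-Library.Multiset"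
begin

text \<open>
  Write \<open>\<alpha> = s / m\<close> and \<open>t = k - l\<close>, so that an edge splits in many ways into an \<open>l\<close>-set \<open>T\<close> and a
  \<open>t\<close>-set \<open>T'\<close>, and \<open>t < l\<close>. Everything is driven by one pattern. Vertices are coloured by pairs
  (position, label), the positions being the points of a cycle of length \<open>m\<close>. A \<open>t\<close>-set has a
  \<^emph>\<open>leader\<close>, the position of one of its vertices, selected from the multiset of its colours alone.
  A colouring is \<^emph>\<open>admissible\<close> if, whenever \<open>T\<close> is monochromatic and \<open>T \<union> T'\<close> is an edge, the leader of
  \<open>T'\<close> lies on the arc of the \<open>s\<close> positions that follow the position of \<open>T\<close>. The family consists of all
  \<open>k\<close>-graphs on a fixed, large number of vertices that have no admissible colouring.

  \<^emph>\<open>Lower bound.\<close> Colour \<open>n\<close> vertices evenly and take all edges that admissibility permits. Because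
  \<open>2 * l > k\<close>, two monochromatic \<open>l\<close>-sets in one edge meet and have the same colour, and because the leader
  depends on colours only, they impose the same condition on the edge. So a monochromatic \<open>T\<close> has
  exactly the \<open>t\<close>-sets with leader on its arc as neighbours. The labels make the leader of a random
  \<open>t\<close>-set exactly uniform (\<open>card_leader_eq\<close>), so these form the fraction \<open>s / m\<close>. A \<open>T\<close> that is not
  monochromatic loses only \<open>t\<close>-sets that share a colour with it, and there are enough labels to make
  these at most the fraction \<open>1 / m\<close> (\<open>degree_host\<close>).

  \<^emph>\<open>Upper bound.\<close> Let all degrees of \<open>H\<close> exceed the fraction \<open>s / m\<close> by a fixed amount. Start from a large set
  of vertices and enlarge it \<open>m\<close> times: whenever the links of some \<open>l\<close>-sets of the current set share a
  large matching of \<open>t\<close>-sets, add the vertices of such a matching. The result has bounded size and has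
  no admissible colouring (\<open>uncolourable_subset\<close>). Given one, let \<open>A\<^sub>i\<close> be the set of positions of the
  monochromatic \<open>l\<close>-sets at stage \<open>i\<close>. These sets grow inside a set of size \<open>m\<close>, so \<open>A\<^sub>i = A\<^sub>i\<^sub>+\<^sub>1 = A\<close> for some \<open>i\<close>.
  A jump argument on the cycle gives a nonempty \<open>B \<subseteq> A\<close> such that each \<open>y \<in> A\<close> is on the arcs of at
  most \<open>s / m\<close> of the elements of \<open>B\<close> (\<open>arc_certificate\<close>). Choose for each element of \<open>B\<close> an \<open>l\<close>-set of
  its position. By averaging, more than \<open>s / m\<close> of these \<open>l\<close>-sets have a positive proportion of all
  \<open>t\<close>-sets as common neighbours, hence share a large matching (\<open>popular_subfamily\<close>), whose vertices appear
  at the next stage. By pigeonhole, \<open>l\<close> members of this matching have the same colour sequence, and their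
  leading vertices form a monochromatic \<open>l\<close>-set. Its position \<open>y\<close> lies in \<open>A\<close>, and
  by admissibility it is on more than \<open>s / m\<close> of the arcs, a contradiction.

  The size of the uncolourable set depends only on \<open>k\<close>, \<open>l\<close>, \<open>m\<close>, and not on the excess in
  the degrees; this is why one finite family gives the exact value \<open>s / m\<close>.
\<close>

section \<open>Arcs on a cycle\<close>

definition ahead :: "nat \<Rightarrow> nat \<Rightarrow> nat \<Rightarrow> nat" where
  "ahead m a y = (y + (m - a)) mod m"

lemma ahead_if: "a < m \<Longrightarrow> y < m \<Longrightarrow> ahead m a y = (if a \<le> y then y - a else y + m - a)"
  unfolding ahead_def by (auto simp: mod_if)

text \<open>The inequality behind the jump argument. Think of jumping from \<open>a\<close> to \<open>b\<close> and measure both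
  points by their distance after \<open>y\<close>. The distance grows by the length of the jump, minus \<open>m\<close> if the jump
  reaches or passes \<open>y\<close>. If \<open>y\<close> is on the arc of \<open>a\<close> and the jump goes at least as far as \<open>y\<close>, this
  happens, and the summand \<open>m\<close> on the left pays for it.\<close>

lemma ahead_step:
  assumes "a < m" "b < m" "y < m" "ahead m a y \<in> {1..s} \<Longrightarrow> ahead m a y \<le> ahead m a b"
  shows "m * (if ahead m a y \<in> {1..s} then 1 else 0) + ahead m y b \<le> ahead m a b + ahead m y a"
  using assms by (auto simp: ahead_if)

text \<open>A nonempty subset closed under \<open>f\<close> and of least size is its own image, since its image is closed too.\<close>

lemma invariant_subset:
  assumes "finite A" "A \<noteq> {}" "f ` A \<subseteq> A"
  obtains B where "B \<subseteq> A" "B \<noteq> {}" "f ` B = B"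
proof -
  let ?P = "\<lambda>B. B \<subseteq> A \<and> B \<noteq> {} \<and> f ` B \<subseteq> B"
  obtain B where B: "?P B" "\<And>C. ?P C \<Longrightarrow> card B \<le> card C"
    using ex_has_least_nat[of ?P A card] assms by auto
  have "finite (f ` B)" using B(1) assms(1) finite_subset by blast
  moreover have "?P (f ` B)" using B(1) by blast
  ultimately have "f ` B = B"
    using B by (meson card_seteq finite_subset assms(1))
  with B(1) that show thesis by blast
qed

text \<open>If the arc of some \<open>a \<in> A\<close> misses \<open>A\<close>, then \<open>{a}\<close> works. Otherwise every \<open>a\<close> jumps to the last
  point of \<open>A\<close> on its arc. On a set \<open>B\<close> permuted by the jumps, summing the inequality of \<open>ahead_step\<close>
  makes the distances from \<open>y\<close> cancel: a point \<open>y \<in> A\<close> is on the arc of a jumper only when it is reached or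
  passed, and the jumps are too short to pass it more than \<open>s * card B / m\<close> times.\<close>

lemma arc_certificate:
  assumes A: "A \<subseteq> {..<m}" "A \<noteq> {}"
  obtains B where "B \<subseteq> A" "B \<noteq> {}"
    "\<And>y. y \<in> A \<Longrightarrow> m * card {a\<in>B. ahead m a y \<in> {1..s}} \<le> s * card B"
proof (cases "\<exists>a\<in>A. \<forall>y\<in>A. ahead m a y \<notin> {1..s}")
  case True
  then obtain a where a: "a \<in> A" "\<forall>y\<in>A. ahead m a y \<notin> {1..s}" by blast
  have "{b \<in> {a}. ahead m b y \<in> {1..s}} = {}" if "y \<in> A" for y using a that by blast
  then have "m * card {b \<in> {a}. ahead m b y \<in> {1..s}} \<le> s * card {a}" if "y \<in> A" for y
    using that by (metis card.empty le0 mult_0_right)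
  then show thesis using that[of "{a}"] a by blast
next
  case False
  have finA: "finite A" using A finite_subset by blast
  have "\<exists>b\<in>A. ahead m a b \<in> {1..s} \<and> (\<forall>y\<in>A. ahead m a y \<in> {1..s} \<longrightarrow> ahead m a y \<le> ahead m a b)"
    if "a \<in> A" for a
  proof -
    let ?S = "{y\<in>A. ahead m a y \<in> {1..s}}"
    have "finite ?S" "?S \<noteq> {}" using finA False that by auto
    then have "Max (ahead m a ` ?S) \<in> ahead m a ` ?S" by (intro Max_in) auto
    then obtain b where "b \<in> ?S" "Max (ahead m a ` ?S) = ahead m a b" by blast
    with \<open>finite ?S\<close> have "\<forall>y\<in>?S. ahead m a y \<le> ahead m a b"
      using Max_ge[of "ahead m a ` ?S"] by auto
    with \<open>b \<in> ?S\<close> show ?thesis by blast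
  qed
  then have "\<exists>nxt. \<forall>a\<in>A. nxt a \<in> A \<and> ahead m a (nxt a) \<in> {1..s} \<and>
      (\<forall>y\<in>A. ahead m a y \<in> {1..s} \<longrightarrow> ahead m a y \<le> ahead m a (nxt a))"
    by (intro bchoice) blast
  then obtain nxt where *: "\<forall>a\<in>A. nxt a \<in> A \<and> ahead m a (nxt a) \<in> {1..s} \<and>
      (\<forall>y\<in>A. ahead m a y \<in> {1..s} \<longrightarrow> ahead m a y \<le> ahead m a (nxt a))" by (elim exE)
  then have nxt: "nxt a \<in> A" "ahead m a (nxt a) \<le> s" if "a \<in> A" for a
    using that by auto
  have nxt_max: "ahead m a y \<le> ahead m a (nxt a)" if "a \<in> A" "y \<in> A" "ahead m a y \<in> {1..s}" for a y
    using bspec[OF * that(1)] that(2,3) by simp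
  obtain B where B: "B \<subseteq> A" "B \<noteq> {}" "nxt ` B = B"
    by (rule invariant_subset[of A nxt, OF finA A(2)]) (use nxt(1) in auto)
  have finB: "finite B" using B finA finite_subset by blast
  have bij: "bij_betw nxt B B" using B(3) finB by (simp add: bij_betw_def eq_card_imp_inj_on)
  have "m * card {a\<in>B. ahead m a y \<in> {1..s}} \<le> s * card B" if y: "y \<in> A" for y
  proof -
    have "(\<Sum>a\<in>B. m * (if ahead m a y \<in> {1..s} then 1 else 0) + ahead m y (nxt a))
        \<le> (\<Sum>a\<in>B. s + ahead m y a)"
    proof (rule sum_mono)
      fix a assume "a \<in> B"
      then have a: "a \<in> A" using B by blast
      have "a < m" "nxt a < m" "y < m" using a nxt(1) y A by auto
      have "m * (if ahead m a y \<in> {1..s} then 1 else 0) + ahead m y (nxt a)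
          \<le> ahead m a (nxt a) + ahead m y a"
        by (rule ahead_step[OF \<open>a < m\<close> \<open>nxt a < m\<close> \<open>y < m\<close> nxt_max[OF a y]])
      also have "\<dots> \<le> s + ahead m y a" using nxt(2)[OF a] by simp
      finally show "m * (if ahead m a y \<in> {1..s} then 1 else 0) + ahead m y (nxt a) \<le> s + ahead m y a" .
    qed
    moreover have "(\<Sum>a\<in>B. ahead m y (nxt a)) = (\<Sum>a\<in>B. ahead m y a)"
      using sum.reindex_bij_betw[OF bij] .
    moreover have "(\<Sum>a\<in>B. m * (if ahead m a y \<in> {1..s} then 1 else 0))
        = m * card {a\<in>B. ahead m a y \<in> {1..s}}"
      using finB by (simp add: sum.If_cases Int_def flip: sum_distrib_left)
    moreover have "(\<Sum>a\<in>B. s) = s * card B" by simp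
    ultimately show ?thesis unfolding sum.distrib by linarith
  qed
  then show thesis using that B by blast
qed

lemma card_ahead_ge:
  assumes "s < m" "x < m"
  shows "s \<le> card {y. y < m \<and> ahead m x y \<in> {1..s}}"
proof -
  have ahead: "ahead m x ((x + d) mod m) = d" if "d \<in> {1..s}" for d
  proof -
    have "ahead m x ((x + d) mod m) = (x + d + (m - x)) mod m" by (simp add: ahead_def mod_add_left_eq)
    also have "x + d + (m - x) = d + m" using assms(2) by simp
    finally show ?thesis using that assms(1) by simp
  qed
  then have "inj_on (\<lambda>d. (x + d) mod m) {1..s}" by (rule inj_on_inverseI)
  moreover have "(\<lambda>d. (x + d) mod m) ` {1..s} \<subseteq> {y. y < m \<and> ahead m x y \<in> {1..s}}"
    using ahead assms by auto
  ultimately have "card {1..s} \<le> card {y. y < m \<and> ahead m x y \<in> {1..s}}"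
    by (intro card_inj_on_le) auto
  then show ?thesis by simp
qed

section \<open>Leaders of colour multisets\<close>

text \<open>A colour is a pair of a position and a label. The sum of the labels modulo the size \<open>t\<close> is a
  die that selects one of the sorted positions. Hence the leader depends only on the multiset of
  colours, is the position of one of the vertices, and is uniform if the labels are.\<close>

definition leader :: "nat \<Rightarrow> (nat \<times> nat) multiset \<Rightarrow> nat" where
  "leader t M = sorted_list_of_multiset (image_mset fst M) ! (sum_mset (image_mset snd M) mod t)"

lemma leader_mset: "leader t (mset \<eta>) = sort (map fst \<eta>) ! (sum_list (map snd \<eta>) mod t)"
  by (simp add: leader_def flip: mset_map sum_mset_sum_list)

lemma leader_selects:
  assumes "length \<eta> = t" "t > 0"
  shows "\<exists>j<t. fst (\<eta> ! j) = leader t (mset \<eta>)"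
proof -
  have "leader t (mset \<eta>) \<in> set (sort (map fst \<eta>))"
    unfolding leader_mset using assms by (intro nth_mem) simp
  then have "leader t (mset \<eta>) \<in> set (map fst \<eta>)" by simp
  then show ?thesis using assms unfolding in_set_conv_nth by auto
qed

text \<open>Colour sequences of \<open>t\<close>-sets. They are easier to count than multisets and lose nothing, as all
  sequences have the same probability.\<close>

definition words :: "'c set \<Rightarrow> nat \<Rightarrow> 'c list set" where
  "words C n = {xs. set xs \<subseteq> C \<and> length xs = n}"

lemma finite_words: "finite C \<Longrightarrow> finite (words C n)"
  by (simp add: words_def finite_lists_length_eq)

lemma card_words: "finite C \<Longrightarrow> card (words C n) = card C ^ n"
  by (simp add: words_def card_lists_length_eq)

lemma sum_words_Suc:
  "(\<Sum>xs\<in>words C (Suc n). f xs) = (\<Sum>x\<in>C. \<Sum>xs\<in>words C n. f (x # xs))"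
proof -
  have "words C (Suc n) = (\<lambda>(x, xs). x # xs) ` (C \<times> words C n)"
    by (auto simp: words_def length_Suc_conv image_iff)
  moreover have "inj_on (\<lambda>(x, xs). x # xs) (C \<times> words C n)" by (auto simp: inj_on_def)
  ultimately show ?thesis by (simp add: sum.reindex sum.cartesian_product split_def)
qed

lemma sum_indicator_card: "finite S \<Longrightarrow> (\<Sum>x\<in>S. if P x then 1 else 0) = card {x\<in>S. P x}"
  by (simp add: sum.If_cases Int_def)

lemma card_residue:
  assumes "\<kappa> < t"
  shows "card {a \<in> {..<t * l}. (a + c) mod t = \<kappa>} = l"
proof -
  define c' where "c' = c mod t"
  define r where "r = (if c' \<le> \<kappa> then \<kappa> - c' else \<kappa> + t - c')"
  have "c' < t" using assms by (simp add: c'_def)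
  have iff: "(a + c) mod t = \<kappa> \<longleftrightarrow> a mod t = r" for a
  proof -
    define a' where "a' = a mod t"
    have "a' < t" using assms by (simp add: a'_def)
    have "(a + c) mod t = (a' + c') mod t" by (simp add: mod_add_eq a'_def c'_def)
    also have "\<dots> = (if a' + c' < t then a' + c' else a' + c' - t)"
      using \<open>a' < t\<close> \<open>c' < t\<close> by (simp add: le_mod_geq)
    finally have "(a + c) mod t = \<kappa> \<longleftrightarrow> a' = r"
      using assms \<open>a' < t\<close> \<open>c' < t\<close> by (auto simp: r_def)
    then show ?thesis by (simp add: a'_def)
  qed
  have "r < t" using assms \<open>c' < t\<close> by (auto simp: r_def)
  have "{a \<in> {..<t * l}. a mod t = r} = (\<lambda>j. t * j + r) ` {..<l}"
  proof (intro subset_antisym subsetI)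
    fix a assume "a \<in> {a \<in> {..<t * l}. a mod t = r}"
    then have "a = t * (a div t) + r" "a div t < l"
      by (auto simp: less_mult_imp_div_less mult.commute)
    then show "a \<in> (\<lambda>j. t * j + r) ` {..<l}" by blast
  next
    fix a assume "a \<in> (\<lambda>j. t * j + r) ` {..<l}"
    then obtain j where j: "a = t * j + r" "j < l" by blast
    have "t * j + r < t * Suc j" using \<open>r < t\<close> by simp
    also have "\<dots> \<le> t * l" using j(2) by (intro mult_le_mono2) simp
    finally show "a \<in> {a \<in> {..<t * l}. a mod t = r}" using j \<open>r < t\<close> by simp
  qed
  moreover have "inj_on (\<lambda>j. t * j + r) {..<l}" using \<open>r < t\<close> by (auto simp: inj_on_def)
  ultimately show ?thesis by (simp add: iff card_image)
qed

text \<open>The first letter alone makes the sum equidistributed modulo \<open>t\<close>, because \<open>t\<close> divides the number of letters.\<close>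

lemma card_words_sum_mod:
  assumes "\<kappa> < t" "n > 0"
  shows "card {as \<in> words {..<t * l} n. sum_list as mod t = \<kappa>} * t = (t * l) ^ n"
proof -
  obtain n' where n: "n = Suc n'" using assms(2) by (cases n) auto
  have "card {as \<in> words {..<t * l} n. sum_list as mod t = \<kappa>}
      = (\<Sum>a<t*l. \<Sum>as\<in>words {..<t*l} n'. if (a + sum_list as) mod t = \<kappa> then 1 else 0)"
    by (simp add: sum_indicator_card[symmetric] finite_words n sum_words_Suc)
  also have "\<dots> = (\<Sum>as\<in>words {..<t*l} n'. card {a \<in> {..<t * l}. (a + sum_list as) mod t = \<kappa>})"
    by (subst sum.swap) (simp add: sum_indicator_card del: lessThan_iff)
  also have "\<dots> = (t * l) ^ n' * l"
    using card_residue[OF assms(1)] by (simp add: card_words)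
  finally show ?thesis by (simp add: n)
qed

lemma sum_count_words:
  assumes "x < m"
  shows "(\<Sum>xs\<in>words {..<m} n. count (mset xs) x) * m = n * m ^ n"
proof (induction n)
  case 0
  then show ?case by (simp add: words_def)
next
  case (Suc n)
  have "(\<Sum>xs\<in>words {..<m} (Suc n). count (mset xs) x)
      = (\<Sum>y<m. \<Sum>xs\<in>words {..<m} n. (if y = x then 1 else 0) + count (mset xs) x)"
    by (simp add: sum_words_Suc) (intro sum.cong refl, auto)
  also have "\<dots> = m ^ n + m * (\<Sum>xs\<in>words {..<m} n. count (mset xs) x)"
    using assms by (simp add: sum.distrib card_words flip: sum_distrib_left)
  finally show ?case using Suc by (simp add: algebra_simps)
qed

lemma card_positions: "card {\<kappa>. \<kappa> < length xs \<and> xs ! \<kappa> = x} = count (mset xs) x"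
proof -
  have "length (filter (\<lambda>y. y = x) xs) = count (mset xs) x" by (induction xs) auto
  then show ?thesis by (simp add: length_filter_conv_card)
qed

text \<open>Fix the positions. The labels choose each of the \<open>t\<close> places equally often, so the number of
  favourable label sequences is proportional to the multiplicity of \<open>x\<close> among the positions. On
  average over all position sequences this multiplicity is \<open>t / m\<close>, so the leader equals \<open>x\<close> with
  probability exactly \<open>1 / m\<close>.\<close>

lemma card_leader_eq:
  assumes "t > 0" "x < m"
  shows "card {\<eta> \<in> words ({..<m} \<times> {..<t * l}) t. leader t (mset \<eta>) = x} * m = (m * (t * l)) ^ t"
proof -
  let ?X = "words {..<m} t" and ?A = "words {..<t * l} t"
  let ?good = "\<lambda>xs as. sort xs ! (sum_list as mod t) = x"
  have bij: "bij_betw (\<lambda>(xs, as). zip xs as) {(xs, as). xs \<in> ?X \<and> as \<in> ?A \<and> ?good xs as}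
      {\<eta> \<in> words ({..<m} \<times> {..<t * l}) t. leader t (mset \<eta>) = x}"
    by (rule bij_betw_byWitness[where f' = "\<lambda>\<eta>. (map fst \<eta>, map snd \<eta>)"])
      (fastforce simp: words_def leader_mset zip_map_fst_snd dest: set_zip_leftD set_zip_rightD)+
  have S: "{(xs, as). xs \<in> ?X \<and> as \<in> ?A \<and> ?good xs as} = Sigma ?X (\<lambda>xs. {as\<in>?A. ?good xs as})"
    by auto
  have "card {as\<in>?A. ?good xs as} * t = count (mset xs) x * (t * l) ^ t" if xs: "xs \<in> ?X" for xs
  proof -
    have "card {as\<in>?A. ?good xs as}
        = (\<Sum>\<kappa>\<in>{\<kappa>. \<kappa> < t \<and> sort xs ! \<kappa> = x}. card {as\<in>?A. sum_list as mod t = \<kappa>})"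
      using assms by (subst card_UN_disjoint[symmetric])
        (auto simp: finite_words intro!: arg_cong[where f = card])
    then have "card {as\<in>?A. ?good xs as} * t = card {\<kappa>. \<kappa> < t \<and> sort xs ! \<kappa> = x} * (t * l) ^ t"
      using assms by (simp add: sum_distrib_right card_words_sum_mod)
    also have "card {\<kappa>. \<kappa> < t \<and> sort xs ! \<kappa> = x} = count (mset xs) x"
      using xs card_positions[of "sort xs" x] by (simp add: words_def)
    finally show ?thesis .
  qed
  then have "card {(xs, as). xs \<in> ?X \<and> as \<in> ?A \<and> ?good xs as} * t
      = (\<Sum>xs\<in>?X. count (mset xs) x) * (t * l) ^ t"
    unfolding S by (subst card_SigmaI) (simp_all add: finite_words sum_distrib_right)
  then have "card {(xs, as). xs \<in> ?X \<and> as \<in> ?A \<and> ?good xs as} * t * m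
      = t * m ^ t * (t * l) ^ t"
    using sum_count_words[OF assms(2), of t] by (simp add: algebra_simps)
  then have "card {(xs, as). xs \<in> ?X \<and> as \<in> ?A \<and> ?good xs as} * m = (m * (t * l)) ^ t"
    using assms by (simp add: power_mult_distrib)
  then show ?thesis using bij_betw_same_card[OF bij] by simp
qed

section \<open>Matchings in common links\<close>

definition has_matching :: "nat \<Rightarrow> 'a set set \<Rightarrow> bool" where
  "has_matching L \<U> \<longleftrightarrow> (\<exists>M\<subseteq>\<U>. card M = L \<and> pairwise disjnt M)"

text \<open>The union of a largest matching has fewer than \<open>L * t\<close> points and meets every set of the family.
  So a family without a matching of size \<open>L\<close> is negligible against the number of all \<open>t\<close>-sets.\<close>

lemma card_no_matching:
  assumes V: "finite V" and U: "\<U> \<subseteq> nsets V t" and t: "t > 0" and no: "\<not> has_matching L \<U>"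
  shows "card \<U> \<le> L * t * card V ^ (t - 1)"
proof -
  have finU: "finite \<U>" using U V finite_imp_finite_nsets finite_subset by blast
  let ?P = "\<lambda>M. M \<subseteq> \<U> \<and> pairwise disjnt M"
  have "\<exists>M. ?P M \<and> (\<forall>M'. ?P M' \<longrightarrow> card M' \<le> card M)"
    by (rule ex_has_greatest_nat[of _ "{}" _ "Suc (card \<U>)"])
      (use finU in \<open>simp_all add: card_mono le_imp_less_Suc\<close>)
  then obtain M where M: "?P M" "\<And>M'. ?P M' \<Longrightarrow> card M' \<le> card M" by blast
  have finM: "finite M" using M(1) finU finite_subset by blast
  have "card M < L"
  proof (rule ccontr)
    assume "\<not> card M < L"
    then obtain M' where "M' \<subseteq> M" "card M' = L" by (metis not_less obtain_subset_with_card_n)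
    moreover from this M(1) have "M' \<subseteq> \<U>" "pairwise disjnt M'" by (auto intro: pairwise_subset)
    ultimately have "has_matching L \<U>" unfolding has_matching_def by blast
    with no show False by simp
  qed
  have "card (\<Union>M) \<le> (\<Sum>U\<in>M. card U)" by (rule card_Union_le_sum_card)
  also have "\<dots> = card M * t"
  proof -
    have "card U = t" if "U \<in> M" for U using that M(1) U by (auto simp: nsets_def)
    then show ?thesis by simp
  qed
  also have "\<dots> \<le> L * t" using \<open>card M < L\<close> by simp
  finally have cardUM: "card (\<Union>M) \<le> L * t" .
  have sub: "\<Union>M \<subseteq> V" using M(1) U by (auto simp: nsets_def)
  have cover: "\<U> \<subseteq> (\<Union>v\<in>\<Union>M. {U \<in> nsets V t. v \<in> U})"
  proof
    fix X assume X: "X \<in> \<U>"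
    have "\<exists>Y\<in>M. \<not> disjnt X Y"
    proof (rule ccontr)
      assume neg: "\<not> (\<exists>Y\<in>M. \<not> disjnt X Y)"
      have "X \<noteq> {}" using X U t by (auto simp: nsets_def)
      then have "X \<notin> M" using neg by (auto simp: disjnt_def)
      moreover have "?P (insert X M)"
        using neg X M(1) by (auto simp: pairwise_insert disjnt_sym)
      then have "card (insert X M) \<le> card M" by (rule M(2))
      ultimately show False using finM by simp
    qed
    then show "X \<in> (\<Union>v\<in>\<Union>M. {U \<in> nsets V t. v \<in> U})"
      using X U by (auto simp: disjnt_def)
  qed
  have star: "card {U \<in> nsets V t. v \<in> U} \<le> card V ^ (t - 1)" for v
  proof -
    have "inj_on (\<lambda>U. U - {v}) {U \<in> nsets V t. v \<in> U}"
      by (rule inj_onI) blast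
    moreover have "(\<lambda>U. U - {v}) ` {U \<in> nsets V t. v \<in> U} \<subseteq> nsets V (t - 1)"
      by (auto simp: nsets_def)
    ultimately have "card {U \<in> nsets V t. v \<in> U} \<le> card (nsets V (t - 1))"
      using V by (meson card_inj_on_le finite_imp_finite_nsets)
    also have "\<dots> \<le> card V ^ (t - 1)" by (cases "t - 1 \<le> card V") (simp_all add: binomial_le_pow binomial_eq_0)
    finally show ?thesis .
  qed
  have finUM: "finite (\<Union>M)" using sub V finite_subset by blast
  have "card \<U> \<le> card (\<Union>v\<in>\<Union>M. {U \<in> nsets V t. v \<in> U})"
    using finUM V by (intro card_mono[OF _ cover] finite_UN_I) (simp_all add: finite_imp_finite_nsets)
  also have "\<dots> \<le> (\<Sum>v\<in>\<Union>M. card {U \<in> nsets V t. v \<in> U})"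
    using finUM by (rule card_UN_le)
  also have "\<dots> \<le> card (\<Union>M) * card V ^ (t - 1)"
    using sum_bounded_above[of "\<Union>M" _ "card V ^ (t - 1)"] star by simp
  also have "\<dots> \<le> L * t * card V ^ (t - 1)" using cardUM by simp
  finally show ?thesis .
qed

text \<open>Double counting. If every \<open>t\<close>-set whose set of neighbours in \<open>\<B>\<close> is not negligible were adjacent to at
  most the fraction \<open>s / m\<close> of \<open>\<B>\<close>, then the average degree in \<open>\<B>\<close> would exceed \<open>s / m\<close> only by the
  contribution of the negligible common neighbourhoods, of which there are at most \<open>2 ^ card \<B>\<close>. In
  the proof, \<open>P X\<close> is the set of neighbours of \<open>X\<close> in \<open>\<B>\<close>.\<close>

lemma popular_subfamily:
  fixes U :: "'b \<Rightarrow> 'a set set"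
  assumes V: "finite V" and B: "finite \<B>" "\<B> \<noteq> {}" and t: "t > 0"
    and U: "\<And>T. T \<in> \<B> \<Longrightarrow> U T \<subseteq> nsets V t"
    and large: "\<And>T. T \<in> \<B> \<Longrightarrow>
      s * (card V choose t) + m * 2 ^ card \<B> * (L * t * card V ^ (t - 1)) < m * card (U T)"
  shows "\<exists>\<H>\<subseteq>\<B>. s * card \<B> < m * card \<H> \<and> has_matching L (\<Inter>T\<in>\<H>. U T)"
proof (rule ccontr)
  assume contra: "\<not> ?thesis"
  let ?N = "nsets V t" and ?R = "card \<B>"
  define P where "P = (\<lambda>X. {T\<in>\<B>. X \<in> U T})"
  define bad where "bad = {X\<in>?N. s * ?R < m * card (P X)}"
  define D where "D = {\<H>\<in>Pow \<B>. \<H> \<noteq> {} \<and> \<not> has_matching L (\<Inter>T\<in>\<H>. U T)}"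
  have finN: "finite ?N" using V by (simp add: finite_imp_finite_nsets)
  have finD: "finite D" "card D \<le> 2 ^ ?R"
    using B card_mono[of "Pow \<B>" D] by (auto simp: D_def card_Pow)
  have "bad \<subseteq> (\<Union>\<H>\<in>D. \<Inter>T\<in>\<H>. U T)"
  proof
    fix X assume X: "X \<in> bad"
    then have "P X \<noteq> {}" by (auto simp: bad_def)
    moreover have "\<not> has_matching L (\<Inter>T\<in>P X. U T)"
      using contra X by (auto simp: bad_def P_def)
    ultimately have "P X \<in> D" by (auto simp: D_def P_def)
    moreover have "X \<in> (\<Inter>T\<in>P X. U T)" by (auto simp: P_def)
    ultimately show "X \<in> (\<Union>\<H>\<in>D. \<Inter>T\<in>\<H>. U T)" by (rule UN_I)
  qed
  moreover have DN: "(\<Inter>T\<in>\<H>. U T) \<subseteq> ?N" if "\<H> \<in> D" for \<H>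
    using that U unfolding D_def by blast
  ultimately have "card bad \<le> card (\<Union>\<H>\<in>D. \<Inter>T\<in>\<H>. U T)"
    using finD finN by (intro card_mono finite_UN_I finite_subset[OF DN]) auto
  also have "\<dots> \<le> (\<Sum>\<H>\<in>D. card (\<Inter>T\<in>\<H>. U T))" by (rule card_UN_le[OF finD(1)])
  also have "\<dots> \<le> card D * (L * t * card V ^ (t - 1))"
    using sum_bounded_above[of D _ "L * t * card V ^ (t - 1)"] card_no_matching[OF V DN t]
    by (simp add: D_def)
  also have "\<dots> \<le> 2 ^ ?R * (L * t * card V ^ (t - 1))" using finD(2) by (rule mult_le_mono1)
  finally have cardbad: "card bad \<le> 2 ^ ?R * (L * t * card V ^ (t - 1))" .
  have cU: "card (U T) = (\<Sum>X\<in>?N. if X \<in> U T then 1 else 0)" if "T \<in> \<B>" for T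
    using U[OF that] finN by (simp add: sum_indicator_card Int_absorb1 flip: Int_def Collect_conj_eq)
  have "?R * (s * (card V choose t) + m * 2 ^ ?R * (L * t * card V ^ (t - 1)))
      < (\<Sum>T\<in>\<B>. m * card (U T))"
    using sum_strict_mono[of \<B> "\<lambda>_. s * (card V choose t) + m * 2 ^ ?R * (L * t * card V ^ (t - 1))"
        "\<lambda>T. m * card (U T)"] B large by simp
  also have "\<dots> = m * (\<Sum>T\<in>\<B>. \<Sum>X\<in>?N. if X \<in> U T then 1 else 0)"
    using cU by (simp add: sum_distrib_left)
  also have "\<dots> = (\<Sum>X\<in>?N. m * card (P X))"
    using B(1) by (subst sum.swap) (simp add: sum_indicator_card P_def sum_distrib_left)
  also have "\<dots> \<le> (\<Sum>X\<in>?N. s * ?R + (if X \<in> bad then m * ?R else 0))"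
  proof (rule sum_mono)
    fix X assume "X \<in> ?N"
    moreover have "card (P X) \<le> ?R" using B(1) by (auto simp: P_def intro: card_mono)
    ultimately show "m * card (P X) \<le> s * ?R + (if X \<in> bad then m * ?R else 0)"
      by (auto simp: bad_def trans_le_add2)
  qed
  also have "\<dots> = (card V choose t) * (s * ?R) + card bad * (m * ?R)"
  proof -
    have "?N \<inter> bad = bad" by (auto simp: bad_def)
    then show ?thesis using finN by (simp add: sum.distrib sum.If_cases)
  qed
  also have "\<dots> \<le> (card V choose t) * (s * ?R) + 2 ^ ?R * (L * t * card V ^ (t - 1)) * (m * ?R)"
    using cardbad by simp
  finally show False by (simp add: algebra_simps)
qed

lemma monochromatic_subset:
  assumes "finite S" "finite C" "C \<noteq> {}" "f ` S \<subseteq> C" "n * card C \<le> card S"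
  obtains T y where "T \<subseteq> S" "card T = n" "y \<in> C" "\<And>x. x \<in> T \<Longrightarrow> f x = y"
proof -
  have "f \<in> S \<rightarrow> C" using assms by auto
  then obtain y where y: "y \<in> C" "card S \<le> card (f -` {y} \<inter> S) * card C"
    using pigeonhole_card[of f S C] assms by blast
  have "card C > 0" using assms by (simp add: card_gt_0_iff)
  then have "n \<le> card (f -` {y} \<inter> S)" using y(2) assms(5) by (meson le_trans mult_le_cancel2 )
  then obtain T where "T \<subseteq> f -` {y} \<inter> S" "card T = n"
    by (meson obtain_subset_with_card_n)
  then show thesis using that y(1) by blast
qed

lemma chain_stabilises:
  assumes "\<And>i. A i \<subseteq> A (Suc i)" "\<And>i. i \<le> m \<Longrightarrow> A i \<subseteq> {..<m::nat}" "A 0 \<noteq> {}"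
  obtains i where "i < m" "A (Suc i) = A i"
proof -
  have "\<exists>i<m. A (Suc i) = A i"
  proof (rule ccontr)
    assume neg: "\<not> ?thesis"
    have "i < card (A i)" if "i \<le> m" for i using that
    proof (induction i)
      case 0
      then show ?case using assms(2)[of 0] assms(3) finite_subset by (fastforce simp: card_gt_0_iff)
    next
      case (Suc i)
      have "A i \<subset> A (Suc i)" using neg Suc.prems assms(1)[of i] Suc_le_lessD by blast
      moreover have "finite (A (Suc i))" using assms(2)[OF Suc.prems] finite_subset by blast
      ultimately have "card (A i) < card (A (Suc i))" by (simp add: psubset_card_mono)
      with Suc show ?case by simp
    qed
    then have "m < card (A m)" by simp
    moreover have "card (A m) \<le> m" using card_mono[OF _ assms(2)[of m]] by simp
    ultimately show False by simp
  qed
  then show thesis using that by blast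
qed

definition link :: "nat \<Rightarrow> 'a hypergraph \<Rightarrow> 'a set \<Rightarrow> 'a set set" where
  "link k H T = {T' \<in> nsets (verts H - T) (k - card T). T \<union> T' \<in> edges H}"

lemma degree_link: "degree k H T = card (link k H T)"
  by (simp add: degree_def link_def)

section \<open>Admissible colourings\<close>

text \<open>The assumption \<open>k < 2 * l\<close> makes any two \<open>l\<close>-subsets of an edge meet, so an edge has at most one
  colour that occurs on \<open>l\<close> of its vertices.\<close>

locale circular_pattern =
  fixes k l m s :: nat
  assumes l_less: "l < k" and majority: "k < 2 * l" and s_less: "s < m"
begin

text \<open>There are \<open>(k - l) * l\<close> labels: a multiple of \<open>k - l\<close>, so that the leader is uniform, and enough of
  them that a \<open>(k - l)\<close>-set rarely shares a colour with a given \<open>l\<close>-set.\<close>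

abbreviation palette :: "(nat \<times> nat) set" where
  "palette \<equiv> {..<m} \<times> {..<(k - l) * l}"

text \<open>The condition is on the complement of every monochromatic \<open>l\<close>-set of an edge; edges without such
  a set are free. Since \<open>0 < l < k\<close>, the cardinalities force \<open>T\<close> and \<open>T'\<close> to be finite.\<close>

definition admissible :: "('a \<Rightarrow> nat \<times> nat) \<Rightarrow> 'a set set \<Rightarrow> bool" where
  "admissible c E \<longleftrightarrow>
     (\<forall>T T' p. card T = l \<longrightarrow> card T' = k - l \<longrightarrow> T \<inter> T' = {} \<longrightarrow> T \<union> T' \<in> E \<longrightarrow> (\<forall>v\<in>T. c v = p) \<longrightarrow>
        ahead m (fst p) (leader (k - l) (image_mset c (mset_set T'))) \<in> {1..s})"

definition colourable :: "'a set \<Rightarrow> 'a set set \<Rightarrow> bool" where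
  "colourable W E \<longleftrightarrow> (\<exists>c. c ` W \<subseteq> palette \<and> admissible c {e \<in> E. e \<subseteq> W})"

text \<open>This is \<open>k\<close> times the number of colour sequences of \<open>(k - l)\<close>-sets, so that a matching of this size
  has many members with the same colour sequence.\<close>

definition matching_size :: nat where
  "matching_size = k * card palette ^ (k - l)"

text \<open>A bound on the size of a set of \<open>matching_size\<close> vertices after \<open>m\<close> enlargements, each of which adds
  one matching for every family of \<open>l\<close>-subsets. A set of size \<open>b\<close> has at most \<open>2 ^ (2 ^ b)\<close> such families.\<close>

definition closure_size :: nat where
  "closure_size = ((\<lambda>b. b + 2 ^ (2 ^ b) * (matching_size * (k - l))) ^^ m) matching_size"

lemma l_pos: "0 < l" and codim_pos: "0 < k - l" and m_pos: "0 < m"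
  using l_less majority s_less by auto

lemma finite_palette: "finite palette"
  by simp

lemma palette_nonempty: "palette \<noteq> {}"
proof -
  have "(0, 0) \<in> palette" using l_pos codim_pos m_pos by simp
  then show ?thesis by blast
qed

lemma palette_pos: "0 < card palette"
  using card_gt_0_iff[of palette] finite_palette palette_nonempty by blast

lemma matching_size_ge: "k * card palette \<le> matching_size"
  unfolding matching_size_def using palette_pos codim_pos by (metis mult_le_mono2 self_le_power Suc_leI One_nat_def)

lemma matching_size_pos: "0 < matching_size"
  unfolding matching_size_def using palette_pos l_less by (metis gr0I mult_is_0 not_less_zero power_not_zero)

section \<open>Bounded uncolourable sets in graphs of large degree\<close>

text \<open>Enough members of the matching have the same colour sequence, hence the same leader, which is the
  position of their \<open>j\<close>-th vertices for a common \<open>j\<close>. These vertices are distinct, as the members are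
  disjoint, and they form the monochromatic set. This step turns information about \<open>(k - l)\<close>-sets in a link
  into a new \<open>l\<close>-set of known position.\<close>

lemma matching_monochromatic_leader:
  fixes c :: "'a::linorder \<Rightarrow> nat \<times> nat"
  assumes M: "M \<subseteq> nsets W (k - l)" "card M = matching_size" "pairwise disjnt M"
    and c: "c ` W \<subseteq> palette"
  obtains T X p where "T \<in> nsets W l" "\<And>v. v \<in> T \<Longrightarrow> c v = p" "X \<in> M"
    "leader (k - l) (image_mset c (mset_set X)) = fst p"
proof -
  define \<eta> where "\<eta> = (\<lambda>X. map c (sorted_list_of_set X))"
  have fin: "finite X" "card X = k - l" "X \<subseteq> W" if "X \<in> M" for X
    using that M(1) by (auto simp: nsets_def)
  have finM: "finite M" using M(2) matching_size_pos card_ge_0_finite by metis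
  have words: "\<eta> ` M \<subseteq> words palette (k - l)"
  proof
    fix w assume "w \<in> \<eta> ` M"
    then obtain X where X: "X \<in> M" "w = \<eta> X" by blast
    have "set w \<subseteq> palette" using c fin[OF X(1)] X(2) by (auto simp: \<eta>_def)
    moreover have "length w = k - l" using fin[OF X(1)] X(2) by (simp add: \<eta>_def)
    ultimately show "w \<in> words palette (k - l)" by (simp add: words_def)
  qed
  have "l * card (words palette (k - l)) \<le> card M"
    using l_less by (simp add: M(2) matching_size_def card_words finite_palette del: card_cartesian_product)
  moreover have "words palette (k - l) \<noteq> {}" using words M(2) matching_size_pos by auto
  ultimately obtain M' w where M': "M' \<subseteq> M" "card M' = l" and w: "w \<in> words palette (k - l)"
      and eta: "\<And>X. X \<in> M' \<Longrightarrow> \<eta> X = w"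
    using monochromatic_subset[of M "words palette (k - l)" \<eta> l] finM words
    by (metis finite_words finite_palette)
  have lenw: "length w = k - l" using w by (simp add: words_def)
  obtain j where j: "j < k - l" "fst (w ! j) = leader (k - l) (mset w)"
    using leader_selects[OF lenw codim_pos] by blast
  define f where "f = (\<lambda>X :: 'a set. sorted_list_of_set X ! j)"
  have f: "f X \<in> X" "c (f X) = w ! j" if "X \<in> M'" for X
  proof -
    have X: "finite X" "card X = k - l" using fin that M' by auto
    then have len: "j < length (sorted_list_of_set X)" using j by simp
    from nth_mem[OF len] show "f X \<in> X" using X by (simp add: f_def)
    have "c (f X) = \<eta> X ! j" using len by (simp add: f_def \<eta>_def)
    then show "c (f X) = w ! j" using eta that by simp
  qed
  have "inj_on f M'"
  proof (rule inj_onI)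
    fix X Y assume XY: "X \<in> M'" "Y \<in> M'" "f X = f Y"
    then have "\<not> disjnt X Y" using f(1)[of X] f(1)[of Y] by (auto simp: disjnt_def)
    then show "X = Y" using XY M(3) M'(1) unfolding pairwise_def by blast
  qed
  then have "card (f ` M') = l" using M'(2) by (simp add: card_image)
  moreover have "f ` M' \<subseteq> W" using f(1) fin(3) M'(1) by blast
  ultimately have T: "f ` M' \<in> nsets W l" using l_pos card_ge_0_finite by (auto simp: nsets_def)
  have "M' \<noteq> {}" using M'(2) l_pos by auto
  then obtain X where X: "X \<in> M'" by blast
  have "mset w = image_mset c (mset_set X)"
    using eta[OF X] by (metis \<eta>_def mset_map mset_sorted_list_of_multiset sorted_list_of_mset_set)
  then show thesis using that[OF T, of "w ! j" X] f(2) X M'(1) j(2) by auto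
qed

text \<open>The core of the upper bound. The hypothesis \<open>pop\<close> concerns \<open>H\<close> alone; the colouring is chosen only
  after \<open>W\<close>. Therefore the enlargement has to serve every family \<open>\<H>\<close> that any colouring could single out.\<close>

lemma uncolourable_subset:
  fixes H :: "'a::linorder hypergraph"
  assumes H: "k_graph k H" "matching_size \<le> card (verts H)"
    and pop: "\<And>\<B>. \<B> \<subseteq> nsets (verts H) l \<Longrightarrow> \<B> \<noteq> {} \<Longrightarrow> card \<B> \<le> m \<Longrightarrow>
      \<exists>\<H>\<subseteq>\<B>. s * card \<B> < m * card \<H> \<and> has_matching matching_size (\<Inter>T\<in>\<H>. link k H T)"
  obtains W where "W \<subseteq> verts H" "card W \<le> closure_size" "\<not> colourable W (edges H)"
proof -
  let ?V = "verts H"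
  have finV: "finite ?V" using H(1) by (simp add: k_graph_def)
  define common where "common = (\<lambda>\<H>. \<Inter>T\<in>\<H>. link k H T)"
  define pick where "pick = (\<lambda>\<H>. if \<H> \<noteq> {} \<and> \<H> \<subseteq> nsets ?V l \<and> has_matching matching_size (common \<H>)
      then SOME M. M \<subseteq> common \<H> \<and> card M = matching_size \<and> pairwise disjnt M else {})"
  have pick: "pick \<H> \<subseteq> common \<H>" "card (pick \<H>) = matching_size" "pairwise disjnt (pick \<H>)"
    if "\<H> \<noteq> {}" "\<H> \<subseteq> nsets ?V l" "has_matching matching_size (common \<H>)" for \<H>
  proof -
    have "pick \<H> = (SOME M. M \<subseteq> common \<H> \<and> card M = matching_size \<and> pairwise disjnt M)"
      using that by (simp add: pick_def)
    moreover have "\<exists>M. M \<subseteq> common \<H> \<and> card M = matching_size \<and> pairwise disjnt M"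
      using that(3) by (simp add: has_matching_def)
    ultimately show "pick \<H> \<subseteq> common \<H>" "card (pick \<H>) = matching_size" "pairwise disjnt (pick \<H>)"
      using someI_ex[of "\<lambda>M. M \<subseteq> common \<H> \<and> card M = matching_size \<and> pairwise disjnt M"] by auto
  qed
  have common_nsets: "common \<H> \<subseteq> nsets ?V (k - l)" if "\<H> \<noteq> {}" "\<H> \<subseteq> nsets ?V l" for \<H>
  proof
    fix X assume X: "X \<in> common \<H>"
    obtain T where T: "T \<in> \<H>" using \<open>\<H> \<noteq> {}\<close> by blast
    then have "card T = l" using that(2) by (auto simp: nsets_def)
    moreover have "X \<in> link k H T" using X T by (simp add: common_def)
    ultimately show "X \<in> nsets ?V (k - l)" by (auto simp: link_def nsets_def)
  qed
  have pick_card: "card (\<Union>(pick \<H>)) \<le> matching_size * (k - l)" and pick_sub: "pick \<H> \<subseteq> nsets ?V (k - l)" for \<H>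
  proof -
    consider "pick \<H> = {}" | "\<H> \<noteq> {}" "\<H> \<subseteq> nsets ?V l" "has_matching matching_size (common \<H>)"
      by (cases "\<H> \<noteq> {} \<and> \<H> \<subseteq> nsets ?V l \<and> has_matching matching_size (common \<H>)")
        (auto simp: pick_def)
    then have "pick \<H> \<subseteq> nsets ?V (k - l) \<and> card (pick \<H>) \<le> matching_size"
    proof cases
      case 2
      then show ?thesis using pick[OF 2] common_nsets[OF 2(1,2)] by auto
    qed auto
    then show "pick \<H> \<subseteq> nsets ?V (k - l)" ..
    have "card (\<Union>(pick \<H>)) \<le> (\<Sum>X\<in>pick \<H>. card X)" by (rule card_Union_le_sum_card)
    also have "\<dots> = (\<Sum>X\<in>pick \<H>. k - l)"
      using \<open>_ \<and> _\<close> by (intro sum.cong) (auto simp: nsets_def)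
    also have "\<dots> \<le> matching_size * (k - l)" using \<open>_ \<and> _\<close> by simp
    finally show "card (\<Union>(pick \<H>)) \<le> matching_size * (k - l)" .
  qed
  define close where "close = (\<lambda>W. W \<union> (\<Union>\<H>\<in>Pow (nsets W l). \<Union>(pick \<H>)))"
  obtain W0 where W0: "W0 \<subseteq> ?V" "card W0 = matching_size" using H(2) by (meson obtain_subset_with_card_n)
  define W where "W = (\<lambda>i. (close ^^ i) W0)"
  have W_Suc: "W (Suc i) = close (W i)" for i by (simp add: W_def)
  have W_mono: "W i \<subseteq> W (Suc i)" for i by (auto simp: W_Suc close_def)
  have W_le: "W i \<subseteq> W j" if "i \<le> j" for i j by (rule lift_Suc_mono_le[of W, OF W_mono that])
  have W_sub: "W i \<subseteq> ?V" for i
  proof (induction i)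
    case 0
    then show ?case using W0 by (simp add: W_def)
  next
    case (Suc i)
    have "\<Union>(pick \<H>) \<subseteq> ?V" for \<H> using pick_sub[of \<H>] by (auto simp: nsets_def)
    then show ?case using Suc by (auto simp: W_Suc close_def)
  qed
  have W_card: "card (W i) \<le> ((\<lambda>b. b + 2 ^ (2 ^ b) * (matching_size * (k - l))) ^^ i) matching_size" for i
  proof (induction i)
    case 0
    then show ?case using W0 by (simp add: W_def)
  next
    case (Suc i)
    let ?b = "((\<lambda>b. b + 2 ^ (2 ^ b) * (matching_size * (k - l))) ^^ i) matching_size"
    have finW: "finite (W i)" using W_sub finV finite_subset by blast
    have "card (nsets (W i) l) \<le> 2 ^ card (W i)" by (simp add: binomial_le_pow2)
    also have "\<dots> \<le> 2 ^ ?b" using Suc by (simp add: power_increasing)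
    finally have "card (Pow (nsets (W i) l)) \<le> 2 ^ (2 ^ ?b)"
      using finW by (simp add: card_Pow finite_imp_finite_nsets power_increasing del: card_nsets)
    moreover have "card (\<Union>\<H>\<in>Pow (nsets (W i) l). \<Union>(pick \<H>))
        \<le> (\<Sum>\<H>\<in>Pow (nsets (W i) l). card (\<Union>(pick \<H>)))"
      using finW by (intro card_UN_le) (simp add: finite_imp_finite_nsets)
    moreover have "\<dots> \<le> card (Pow (nsets (W i) l)) * (matching_size * (k - l))"
      using sum_bounded_above[of "Pow (nsets (W i) l)" _ "matching_size * (k - l)"] pick_card by simp
    ultimately have "card (\<Union>\<H>\<in>Pow (nsets (W i) l). \<Union>(pick \<H>)) \<le> 2 ^ (2 ^ ?b) * (matching_size * (k - l))"
      by (meson le_trans mult_le_mono1)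
    then have "card (W (Suc i)) \<le> ?b + 2 ^ (2 ^ ?b) * (matching_size * (k - l))"
      using Suc card_Un_le[of "W i" "\<Union>\<H>\<in>Pow (nsets (W i) l). \<Union>(pick \<H>)"]
      unfolding W_Suc close_def by linarith
    then show ?case by simp
  qed
  have "\<not> colourable (W m) (edges H)"
  proof
    assume "colourable (W m) (edges H)"
    then obtain c where c: "c ` W m \<subseteq> palette" "admissible c {e \<in> edges H. e \<subseteq> W m}"
      by (auto simp: colourable_def)
    define A where "A = (\<lambda>i. {x. \<exists>T\<in>nsets (W i) l. \<exists>a. \<forall>v\<in>T. c v = (x, a)})"
    have A_mono: "A i \<subseteq> A (Suc i)" for i
      unfolding A_def using nsets_mono[OF W_mono[of i], of l] by blast
    have A_sub: "A i \<subseteq> {..<m}" if "i \<le> m" for i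
    proof
      fix x assume "x \<in> A i"
      then obtain T a where T: "T \<in> nsets (W i) l" "\<forall>v\<in>T. c v = (x, a)" by (auto simp: A_def)
      then obtain v where "v \<in> T" using l_pos by (fastforce simp: nsets_def)
      then have "v \<in> W m" "c v = (x, a)" using T W_le[OF that] by (auto simp: nsets_def)
      then have "(x, a) \<in> palette" using c(1) by (metis imageI subsetD)
      then show "x \<in> {..<m}" by simp
    qed
    have A0: "A 0 \<noteq> {}"
    proof -
      have finW0: "finite W0" using W0 finV finite_subset by blast
      have "W0 \<subseteq> W m" using W_le[of 0 m] by (simp add: W_def)
      moreover have "l * card palette \<le> card W0"
        using order_trans[OF mult_le_mono1[OF less_imp_le[OF l_less]] matching_size_ge] W0(2) by simp
      ultimately obtain T y where T: "T \<subseteq> W0" "card T = l" "\<And>x. x \<in> T \<Longrightarrow> c x = y"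
        using monochromatic_subset[of W0 palette c l] finW0 finite_palette palette_nonempty c(1)
        by (metis image_mono order_trans)
      then have "T \<in> nsets (W 0) l" using finW0 finite_subset by (auto simp: W_def nsets_def)
      then have "fst y \<in> A 0" using T(3) unfolding A_def by (auto intro!: bexI[of _ T] exI[of _ "snd y"])
      then show ?thesis by blast
    qed
    \<comment> \<open>At such a stage every position that the common links lead to is represented already.\<close>
    obtain i where i: "i < m" "A (Suc i) = A i"
      by (rule chain_stabilises[of A m, OF A_mono A_sub A0])
    have "A 0 \<subseteq> A i" by (rule lift_Suc_mono_le[of A, OF A_mono]) simp
    then have Ai: "A i \<noteq> {}" using A0 by blast
    obtain B where B: "B \<subseteq> A i" "B \<noteq> {}"
      and cert: "\<And>y. y \<in> A i \<Longrightarrow> m * card {a\<in>B. ahead m a y \<in> {1..s}} \<le> s * card B"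
      by (rule arc_certificate[OF A_sub[OF less_imp_le[OF i(1)]] Ai, of s]) blast
    have Bm: "B \<subseteq> {..<m}" using B(1) A_sub[of i] i(1) by auto
    then have finB: "finite B" using finite_subset by blast
    have "\<forall>a\<in>B. \<exists>T. T \<in> nsets (W i) l \<and> (\<exists>b. \<forall>v\<in>T. c v = (a, b))"
    proof
      fix a assume "a \<in> B"
      then have "a \<in> A i" using B(1) by blast
      then show "\<exists>T. T \<in> nsets (W i) l \<and> (\<exists>b. \<forall>v\<in>T. c v = (a, b))" by (auto simp: A_def)
    qed
    from bchoice[OF this] obtain rep
      where *: "\<forall>a\<in>B. rep a \<in> nsets (W i) l \<and> (\<exists>b. \<forall>v\<in>rep a. c v = (a, b))"
      by (elim exE)
    have rep: "rep a \<in> nsets (W i) l" "\<exists>b. \<forall>v\<in>rep a. c v = (a, b)" if "a \<in> B" for a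
      using bspec[OF * that] by auto
    have rep_ne: "rep a \<noteq> {}" if "a \<in> B" for a using rep(1)[OF that] l_pos by (auto simp: nsets_def)
    have inj: "inj_on rep B"
    proof (rule inj_onI)
      fix a b assume ab: "a \<in> B" "b \<in> B" "rep a = rep b"
      obtain v where "v \<in> rep a" using rep_ne[OF ab(1)] by blast
      then show "a = b" using rep(2)[OF ab(1)] rep(2)[OF ab(2)] ab(3) by force
    qed
    have nsets_sub: "nsets (W i) l \<subseteq> nsets ?V l" by (rule nsets_mono[OF W_sub])
    have "\<exists>\<H>\<subseteq>rep ` B. s * card (rep ` B) < m * card \<H> \<and> has_matching matching_size (\<Inter>T\<in>\<H>. link k H T)"
    proof (rule pop)
      show "rep ` B \<subseteq> nsets ?V l" using rep(1) nsets_sub by blast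
      show "rep ` B \<noteq> {}" using B(2) by simp
      show "card (rep ` B) \<le> m" using card_mono[OF _ Bm] by (simp add: card_image[OF inj])
    qed
    then obtain \<H> where \<H>: "\<H> \<subseteq> rep ` B" "s * card B < m * card \<H>" "has_matching matching_size (common \<H>)"
      by (auto simp: card_image[OF inj] common_def)
    have \<H>W: "\<H> \<subseteq> nsets (W i) l" using \<H>(1) rep(1) by blast
    have \<H>ne: "\<H> \<noteq> {}" using \<H>(2) by auto
    note M = pick[OF \<H>ne order_trans[OF \<H>W nsets_sub] \<H>(3)]
    have MW: "\<Union>(pick \<H>) \<subseteq> W (Suc i)" using \<H>W by (auto simp: W_Suc close_def)
    have W_Suc_le: "W (Suc i) \<subseteq> W m" using i(1) by (intro W_le) simp
    have "pick \<H> \<subseteq> nsets (W (Suc i)) (k - l)"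
      using pick_sub[of \<H>] MW by (auto simp: nsets_def)
    then obtain T X p where T: "T \<in> nsets (W (Suc i)) l" "\<And>v. v \<in> T \<Longrightarrow> c v = p"
      and X: "X \<in> pick \<H>" and lead: "leader (k - l) (image_mset c (mset_set X)) = fst p"
      using matching_monochromatic_leader[of "pick \<H>" "W (Suc i)" c] M(2,3) c(1) W_Suc_le
      by (metis image_mono order_trans)
    have "fst p \<in> A (Suc i)"
      unfolding A_def using T by (auto intro!: bexI[of _ T] exI[of _ "snd p"])
    then have y: "fst p \<in> A i" using i(2) by simp
    \<comment> \<open>The matching found for \<open>\<H>\<close> is a witness that one single position lies on all arcs of \<open>\<H>\<close>.\<close>
    have hit: "ahead m a (fst p) \<in> {1..s}" if a: "a \<in> B" "rep a \<in> \<H>" for a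
    proof -
      obtain b where b: "\<forall>v\<in>rep a. c v = (a, b)" using rep(2)[OF a(1)] by blast
      have ra: "card (rep a) = l" "rep a \<subseteq> W m"
        using rep(1)[OF a(1)] W_le[of i m] i(1) by (auto simp: nsets_def)
      have "X \<in> link k H (rep a)" using X M(1) a(2) by (auto simp: common_def)
      then have XX: "card X = k - l" "rep a \<inter> X = {}" "rep a \<union> X \<in> edges H"
        using ra by (auto simp: link_def nsets_def)
      moreover have "X \<subseteq> W m" using X MW W_Suc_le by blast
      ultimately have "rep a \<union> X \<in> {e \<in> edges H. e \<subseteq> W m}" using ra by auto
      then have "ahead m (fst (a, b)) (leader (k - l) (image_mset c (mset_set X))) \<in> {1..s}"
        using c(2) XX ra(1) b unfolding admissible_def by blast
      then show ?thesis by (simp add: lead)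
    qed
    have "\<H> \<subseteq> rep ` {a\<in>B. ahead m a (fst p) \<in> {1..s}}" using \<H>(1) hit by blast
    then have "card \<H> \<le> card (rep ` {a\<in>B. ahead m a (fst p) \<in> {1..s}})"
      using finB by (intro card_mono) auto
    also have "\<dots> \<le> card {a\<in>B. ahead m a (fst p) \<in> {1..s}}" using finB by (intro card_image_le) auto
    finally have "m * card \<H> \<le> s * card B" using cert[OF y] by (meson le_trans mult_le_mono2)
    then show False using \<H>(2) by simp
  qed
  then show thesis using that[of "W m"] W_sub W_card[of m] by (simp add: closure_size_def)
qed

end

section \<open>Asymptotics of degrees\<close>

lemma binomial_shift_tendsto:
  "(\<lambda>n. real ((n - a) choose t) / real n ^ t) \<longlonglongrightarrow> 1 / fact t"
proof -
  have "(\<lambda>n. (\<Prod>i=0..<t. 1 - real (a + i) * inverse (real n)) / fact t) \<longlonglongrightarrow> (\<Prod>i=0..<t. 1 - real (a + i) * 0) / fact t"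
    by (intro tendsto_intros lim_inverse_n) simp
  moreover have "\<forall>\<^sub>F n in sequentially.
      (\<Prod>i=0..<t. 1 - real (a + i) * inverse (real n)) / fact t = real ((n - a) choose t) / real n ^ t"
  proof (rule eventually_sequentiallyI[of "Suc a"])
    fix n assume n: "Suc a \<le> n"
    have "(\<Prod>i=0..<t. real (n - a) - real i) = (\<Prod>i=0..<t. real n * (1 - real (a + i) * inverse (real n)))"
      using n by (intro prod.cong) (auto simp: field_simps of_nat_diff)
    also have "\<dots> = real n ^ t * (\<Prod>i=0..<t. 1 - real (a + i) * inverse (real n))"
      by (simp add: prod.distrib)
    finally have "real ((n - a) choose t) = real n ^ t * (\<Prod>i=0..<t. 1 - real (a + i) * inverse (real n)) / fact t"
      by (simp add: binomial_gbinomial gbinomial_prod_rev)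
    then show "(\<Prod>i=0..<t. 1 - real (a + i) * inverse (real n)) / fact t = real ((n - a) choose t) / real n ^ t"
      using n by simp
  qed
  ultimately show ?thesis by (simp add: Lim_transform_eventually)
qed

text \<open>After division by \<open>n ^ t\<close>, the left side tends to \<open>s / fact t\<close> and the right side to
  \<open>(s + \<epsilon>) / fact t\<close>.\<close>

lemma eventually_degree_beats_negligible:
  fixes \<epsilon> :: real
  assumes "0 < \<epsilon>" "0 < t"
  shows "\<forall>\<^sub>F n in sequentially.
    real (s * (n choose t) + K * n ^ (t - 1)) < (real s + \<epsilon>) * real ((n - a) choose t)"
proof -
  have "(\<lambda>n. real n ^ (t - 1) / real n ^ t) \<longlonglongrightarrow> 0"
  proof (rule Lim_transform_eventually[OF lim_inverse_n])
    show "\<forall>\<^sub>F n in sequentially. inverse (real n) = real n ^ (t - 1) / real n ^ t"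
      using assms(2) by (intro eventually_sequentiallyI[of 1]) (cases t, auto simp: field_simps)
  qed
  then have "(\<lambda>n. (real s + \<epsilon>) * (real ((n - a) choose t) / real n ^ t)
      - (real s * (real ((n - 0) choose t) / real n ^ t) + real K * (real n ^ (t - 1) / real n ^ t)))
    \<longlonglongrightarrow> (real s + \<epsilon>) * (1 / fact t) - (real s * (1 / fact t) + real K * 0)"
    by (intro tendsto_intros binomial_shift_tendsto)
  moreover have "(real s + \<epsilon>) * (1 / fact t) - (real s * (1 / fact t) + real K * 0) > 0"
    using assms(1) by (simp add: field_simps)
  ultimately have "\<forall>\<^sub>F n in sequentially. (real s + \<epsilon>) * (real ((n - a) choose t) / real n ^ t)
      - (real s * (real ((n - 0) choose t) / real n ^ t) + real K * (real n ^ (t - 1) / real n ^ t)) > 0"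
    by (rule order_tendstoD(1))
  then show ?thesis
    using eventually_gt_at_top[of 0]
  proof eventually_elim
    case (elim n)
    then have "0 < ((real s + \<epsilon>) * real ((n - a) choose t) - (real s * real (n choose t) + real K * real n ^ (t - 1))) / real n ^ t"
      by (simp add: diff_divide_distrib add_divide_distrib)
    moreover have "real n ^ t > 0" using elim by simp
    ultimately show ?case by (simp add: zero_less_divide_iff)
  qed
qed

text \<open>All but boundedly many vertices lie in full blocks, and almost all \<open>t\<close>-sets meet each block at most once.\<close>

lemma block_binomial_ratio:
  assumes "0 < q"
  shows "(\<lambda>n. real (q ^ t * ((n div q - l) choose t)) / real ((n - l) choose t)) \<longlonglongrightarrow> 1"
proof -
  have div_top: "filterlim (\<lambda>n. n div q) sequentially sequentially"
  proof (unfold filterlim_at_top, intro allI)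
    fix Z :: nat
    show "\<forall>\<^sub>F n in sequentially. Z \<le> n div q"
      using assms by (intro eventually_sequentiallyI[of "q * Z"]) (simp add: less_eq_div_iff_mult_less_eq mult.commute)
  qed
  have blocks: "(\<lambda>n. real q * real (n div q) / real n) \<longlonglongrightarrow> 1"
  proof (rule tendsto_sandwich)
    show "(\<lambda>n. 1 - real q * inverse (real n)) \<longlonglongrightarrow> 1"
      using tendsto_diff[OF tendsto_const tendsto_mult[OF tendsto_const lim_inverse_n], of 1 "real q"] by simp
    show "(\<lambda>_. 1 :: real) \<longlonglongrightarrow> 1" by simp
    show "\<forall>\<^sub>F n in sequentially. 1 - real q * inverse (real n) \<le> real q * real (n div q) / real n"
    proof (rule eventually_sequentiallyI[of 1])
      fix n :: nat assume "1 \<le> n"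
      have "n \<le> q * (n div q) + q" using assms by (metis add_left_mono less_imp_le mod_less_divisor mult_div_mod_eq)
      then have "real n \<le> real q * real (n div q) + real q" by (simp flip: of_nat_mult of_nat_add)
      then have "(real n - real q) / real n \<le> real q * real (n div q) / real n"
        by (intro divide_right_mono) auto
      moreover have "1 - real q * inverse (real n) = (real n - real q) / real n"
        using \<open>1 \<le> n\<close> by (simp add: field_simps)
      ultimately show "1 - real q * inverse (real n) \<le> real q * real (n div q) / real n" by simp
    qed
    show "\<forall>\<^sub>F n in sequentially. real q * real (n div q) / real n \<le> 1"
    proof (rule eventually_sequentiallyI[of 1])
      fix n :: nat assume "1 \<le> n"
      have "q * (n div q) \<le> n" by simp
      then have "real q * real (n div q) \<le> real n" by (metis of_nat_le_iff of_nat_mult)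
      then show "real q * real (n div q) / real n \<le> 1" using \<open>1 \<le> n\<close> by simp
    qed
  qed
  have "(\<lambda>n. real ((n div q - l) choose t) / real (n div q) ^ t * (real q * real (n div q) / real n) ^ t
        / (real ((n - l) choose t) / real n ^ t)) \<longlonglongrightarrow> (1 / fact t) * 1 ^ t / (1 / fact t)"
    by (intro tendsto_divide tendsto_mult tendsto_power blocks binomial_shift_tendsto
        filterlim_compose[OF binomial_shift_tendsto div_top]) simp
  then have "(\<lambda>n. real ((n div q - l) choose t) / real (n div q) ^ t * (real q * real (n div q) / real n) ^ t
        / (real ((n - l) choose t) / real n ^ t)) \<longlonglongrightarrow> 1" by simp
  then show ?thesis
  proof (rule Lim_transform_eventually)
    show "\<forall>\<^sub>F n in sequentially.
        real ((n div q - l) choose t) / real (n div q) ^ t * (real q * real (n div q) / real n) ^ t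
          / (real ((n - l) choose t) / real n ^ t)
        = real (q ^ t * ((n div q - l) choose t)) / real ((n - l) choose t)"
    proof (rule eventually_sequentiallyI[of q])
      fix n assume "q \<le> n"
      then have "n > 0" "n div q > 0" using assms by (auto simp: div_greater_zero_iff)
      then show "real ((n div q - l) choose t) / real (n div q) ^ t * (real q * real (n div q) / real n) ^ t
          / (real ((n - l) choose t) / real n ^ t)
        = real (q ^ t * ((n div q - l) choose t)) / real ((n - l) choose t)"
        by (simp add: power_mult_distrib power_divide)
    qed
  qed
qed

lemma min_degree_le:
  assumes "finite (verts H)" "T \<in> nsets (verts H) l"
  shows "min_degree k l H \<le> degree k H T"
  unfolding min_degree_def using assms by (intro Min_le) (auto simp: finite_imp_finite_nsets)

lemma min_degree_attained:
  assumes "finite (verts H)" "l \<le> card (verts H)"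
  obtains T where "T \<in> nsets (verts H) l" "min_degree k l H = degree k H T"
proof -
  have "nsets (verts H) l \<noteq> {}" using assms by (simp add: nsets_eq_empty_iff)
  then have "min_degree k l H \<in> degree k H ` nsets (verts H) l"
    unfolding min_degree_def using assms(1) by (intro Min_in) (auto simp: finite_imp_finite_nsets)
  then show thesis using that by blast
qed

section \<open>The finite family and the upper bound\<close>

context circular_pattern
begin

text \<open>Admissibility passes to subgraphs, since it only restricts the edges that are present.\<close>

lemma colourable_pullback:
  assumes f: "inj_on f W" "f ` W \<subseteq> W'" "\<And>e. e \<in> E \<Longrightarrow> e \<subseteq> W \<Longrightarrow> f ` e \<in> E'"
    and col: "colourable W' E'"
  shows "colourable W E"
proof -
  obtain c where c: "c ` W' \<subseteq> palette" "admissible c {e \<in> E'. e \<subseteq> W'}"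
    using col by (auto simp: colourable_def)
  have "admissible (c \<circ> f) {e \<in> E. e \<subseteq> W}"
    unfolding admissible_def
  proof (intro allI impI)
    fix T T' p
    assume T: "card T = l" "card T' = k - l" "T \<inter> T' = {}" "T \<union> T' \<in> {e \<in> E. e \<subseteq> W}"
      and p: "\<forall>v\<in>T. (c \<circ> f) v = p"
    then have sub: "T \<subseteq> W" "T' \<subseteq> W" by auto
    have inj: "inj_on f T" "inj_on f T'" using sub f(1) inj_on_subset by blast+
    have "card (f ` T) = l" "card (f ` T') = k - l" using T inj by (simp_all add: card_image)
    moreover have "f ` T \<inter> f ` T' = {}"
      using T(3) sub f(1) by (metis image_empty inj_on_image_Int)
    moreover have "f ` (T \<union> T') \<in> E'" "f ` (T \<union> T') \<subseteq> W'"
      using f(2) f(3)[of "T \<union> T'"] T(4) image_mono[of "T \<union> T'" W f] by auto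
    then have "f ` T \<union> f ` T' \<in> {e \<in> E'. e \<subseteq> W'}" by (simp add: image_Un)
    moreover have "\<forall>v\<in>f ` T. c v = p" using p by auto
    ultimately have "ahead m (fst p) (leader (k - l) (image_mset c (mset_set (f ` T')))) \<in> {1..s}"
      using c(2) unfolding admissible_def by blast
    then show "ahead m (fst p) (leader (k - l) (image_mset (c \<circ> f) (mset_set T'))) \<in> {1..s}"
      using inj(2) by (simp add: image_mset_mset_set[symmetric] multiset.map_comp)
  qed
  moreover have "(c \<circ> f) ` W \<subseteq> palette" using c(1) f(2) by auto
  ultimately show ?thesis unfolding colourable_def by blast
qed

text \<open>The second summand only ensures that the complete \<open>k\<close>-graph of this order has no admissible colouring:
  it contains a monochromatic edge, in which the leader has the position of the monochromatic \<open>l\<close>-set.\<close>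

definition order_of_obstructions :: nat where
  "order_of_obstructions = closure_size + k * card palette"

definition obstructions :: "nat hypergraph set" where
  "obstructions = {({..<order_of_obstructions}, E) | E.
     E \<subseteq> nsets {..<order_of_obstructions} k \<and> \<not> colourable {..<order_of_obstructions} E}"

lemma finite_obstructions: "finite obstructions"
proof -
  have "obstructions \<subseteq> Pair {..<order_of_obstructions} ` Pow (nsets {..<order_of_obstructions} k)"
    by (auto simp: obstructions_def)
  then show ?thesis by (rule finite_subset) (simp add: finite_imp_finite_nsets)
qed

lemma obstructions_nonempty: "obstructions \<noteq> {}"
proof -
  let ?V = "{..<order_of_obstructions}"
  have "\<not> colourable ?V (nsets ?V k)"
  proof
    assume "colourable ?V (nsets ?V k)"
    then obtain c where c: "c ` ?V \<subseteq> palette" "admissible c {e \<in> nsets ?V k. e \<subseteq> ?V}"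
      by (auto simp: colourable_def)
    have "k * card palette \<le> card ?V"
      by (simp add: order_of_obstructions_def del: card_cartesian_product)
    then obtain S p where S: "S \<subseteq> ?V" "card S = k" "p \<in> palette" "\<And>v. v \<in> S \<Longrightarrow> c v = p"
      using monochromatic_subset[of ?V palette c k] finite_palette palette_nonempty c(1) by blast
    obtain T where T: "T \<subseteq> S" "card T = l" using S(2) l_less by (metis less_imp_le obtain_subset_with_card_n)
    have finS: "finite S" using S(1) finite_subset by blast
    define T' where "T' = S - T"
    have T': "card T' = k - l" "T \<inter> T' = {}" "T \<union> T' = S" "T' \<subseteq> S"
      using T S(2) finS by (auto simp: T'_def card_Diff_subset finite_subset)
    have "T \<union> T' \<in> {e \<in> nsets ?V k. e \<subseteq> ?V}"
      unfolding T'(3) using S(1,2) finS by (simp add: nsets_def)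
    moreover have "\<forall>v\<in>T. c v = p" using T(1) S(4) by blast
    ultimately have ah: "ahead m (fst p) (leader (k - l) (image_mset c (mset_set T'))) \<in> {1..s}"
      using c(2) T(2) T'(1,2) unfolding admissible_def by blast
    have "image_mset c (mset_set T') = image_mset (\<lambda>_. p) (mset_set T')"
      using S(4) T'(4) finS by (intro image_mset_cong) (metis elem_mset_set finite_subset subsetD)
    also have "\<dots> = mset (replicate (k - l) p)"
      using T'(1) by (simp add: image_mset_const_eq)
    finally have "leader (k - l) (image_mset c (mset_set T')) = fst p"
      using leader_selects[of "replicate (k - l) p" "k - l"] codim_pos by auto
    moreover have "fst p < m" using S(3) by auto
    ultimately show False using ah by (simp add: ahead_def)
  qed
  then show ?thesis unfolding obstructions_def by blast
qed

lemma colourable_no_edges: "colourable W {}"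
proof -
  obtain p where "p \<in> palette" using palette_nonempty by blast
  then show ?thesis unfolding colourable_def admissible_def by (intro exI[of _ "\<lambda>_. p"]) auto
qed

lemma obstructions_k_graphs: "F \<in> obstructions \<Longrightarrow> k_graph k F \<and> edges F \<noteq> {}"
  by (auto simp: obstructions_def k_graph_def colourable_no_edges)

lemma colourable_imp_free:
  assumes "colourable (verts H) (edges H)"
  shows "family_free obstructions H"
  unfolding family_free_def
proof (intro ballI notI)
  fix F assume F: "F \<in> obstructions" "contains H F"
  from F(2) obtain f where f: "inj_on f (verts F)" "f ` verts F \<subseteq> verts H"
      "\<forall>e\<in>edges F. f ` e \<in> edges H"
    unfolding contains_def by (elim exE conjE)
  have "colourable (verts F) (edges F)"
    by (rule colourable_pullback[OF f(1,2) _ assms]) (use f(3) in simp)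
  then show False using F(1) by (auto simp: obstructions_def)
qed

text \<open>Padding \<open>W\<close> to exactly \<open>order_of_obstructions\<close> vertices allows all members of the family to have the
  same vertex set.\<close>

lemma free_imp_locally_colourable:
  assumes H: "k_graph k H" "family_free obstructions H" "order_of_obstructions \<le> card (verts H)"
    and W: "W \<subseteq> verts H" "card W \<le> closure_size"
  shows "colourable W (edges H)"
proof -
  let ?n = order_of_obstructions
  have finV: "finite (verts H)" using H(1) by (simp add: k_graph_def)
  have "card W \<le> ?n" using W(2) by (simp add: order_of_obstructions_def)
  then obtain W' where W': "W \<subseteq> W'" "W' \<subseteq> verts H" "card W' = ?n"
    using exists_subset_between[of W ?n "verts H"] H(3) W(1) finV by blast
  have "finite W'" using W'(2) finV finite_subset by blast
  then obtain f where f: "bij_betw f {..<?n} W'"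
    using W'(3) ex_bij_betw_nat_finite[of W'] by (auto simp: atLeast0LessThan)
  define E where "E = {e \<in> nsets {..<?n} k. f ` e \<in> edges H}"
  have "contains H ({..<?n}, E)"
    using f W'(2) unfolding contains_def by (intro exI[of _ f]) (auto simp: E_def bij_betw_def)
  then have "({..<?n}, E) \<notin> obstructions" using H(2) by (auto simp: family_free_def)
  then have col: "colourable {..<?n} E" by (auto simp: obstructions_def E_def)
  define g where "g = the_inv_into {..<?n} f"
  have g: "bij_betw g W' {..<?n}" unfolding g_def using f by (rule bij_betw_the_inv_into)
  have fg: "f (g x) = x" if "x \<in> W'" for x
    using f that unfolding g_def bij_betw_def by (intro f_the_inv_into_f) auto
  show ?thesis
  proof (rule colourable_pullback[OF _ _ _ col])
    show "inj_on g W" using g W'(1) by (auto simp: bij_betw_def intro: inj_on_subset)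
    show "g ` W \<subseteq> {..<?n}" using g W'(1) by (auto simp: bij_betw_def)
    fix e assume e: "e \<in> edges H" "e \<subseteq> W"
    have eW: "e \<subseteq> W'" using e W'(1) by blast
    have "f ` g ` e = e" using fg eW by (force simp: image_iff)
    moreover have "g ` e \<in> nsets {..<?n} k"
    proof -
      have "card e = k" using e(1) H(1) by (auto simp: k_graph_def nsets_def)
      moreover have "inj_on g e" using g eW by (auto simp: bij_betw_def intro: inj_on_subset)
      moreover have "finite e" using eW \<open>finite W'\<close> finite_subset by blast
      ultimately show ?thesis using g eW by (auto simp: nsets_def card_image bij_betw_def)
    qed
    ultimately show "g ` e \<in> E" using e(1) by (simp add: E_def)
  qed
qed

lemma eventually_min_degree_less:
  fixes \<epsilon> :: real
  assumes "0 < \<epsilon>"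
  shows "\<forall>\<^sub>F n in sequentially. \<forall>H :: nat hypergraph.
    k_graph k H \<longrightarrow> card (verts H) = n \<longrightarrow> family_free obstructions H \<longrightarrow>
      real (min_degree k l H) < (real s / real m + \<epsilon>) * real ((n - l) choose (k - l))"
proof -
  let ?t = "k - l"
  define K where "K = m * 2 ^ m * (matching_size * ?t)"
  have "0 < real m * \<epsilon>" using assms m_pos by simp
  from eventually_degree_beats_negligible[OF this codim_pos, of s K l]
    eventually_ge_at_top[of "max matching_size order_of_obstructions"]
  show ?thesis
  proof eventually_elim
    case (elim n)
    show ?case
    proof (intro allI impI, rule ccontr)
      fix H :: "nat hypergraph"
      assume H: "k_graph k H" "card (verts H) = n" "family_free obstructions H"
        and big: "\<not> real (min_degree k l H) < (real s / real m + \<epsilon>) * real ((n - l) choose ?t)"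
      have finV: "finite (verts H)" using H(1) by (simp add: k_graph_def)
      have deg: "s * (n choose ?t) + K * n ^ (?t - 1) < m * card (link k H T)"
        if "T \<in> nsets (verts H) l" for T
      proof -
        have "real (s * (n choose ?t) + K * n ^ (?t - 1)) < (real s + real m * \<epsilon>) * real ((n - l) choose ?t)"
          by (rule elim)
        also have "\<dots> = real m * ((real s / real m + \<epsilon>) * real ((n - l) choose ?t))"
          using m_pos by (simp add: field_simps)
        also have "\<dots> \<le> real m * real (min_degree k l H)" using big by (intro mult_left_mono) auto
        also have "\<dots> \<le> real m * real (card (link k H T))"
          using min_degree_le[OF finV that, of k] by (intro mult_left_mono) (auto simp: degree_link)
        finally show ?thesis by (simp flip: of_nat_mult of_nat_add of_nat_power)
      qed
      have "\<exists>\<H>\<subseteq>\<B>. s * card \<B> < m * card \<H> \<and> has_matching matching_size (\<Inter>T\<in>\<H>. link k H T)"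
        if \<B>: "\<B> \<subseteq> nsets (verts H) l" "\<B> \<noteq> {}" "card \<B> \<le> m" for \<B>
      proof (rule popular_subfamily[OF finV _ \<B>(2) codim_pos])
        show "finite \<B>" using \<B>(1) finV finite_imp_finite_nsets finite_subset by metis
        fix T assume "T \<in> \<B>"
        then have T: "T \<in> nsets (verts H) l" using \<B>(1) by blast
        then show "link k H T \<subseteq> nsets (verts H) ?t" by (auto simp: link_def nsets_def)
        have "m * 2 ^ card \<B> * (matching_size * ?t * n ^ (?t - 1)) \<le> m * 2 ^ m * (matching_size * ?t * n ^ (?t - 1))"
          using \<B>(3) by (intro mult_le_mono1 mult_le_mono2 power_increasing) auto
        also have "\<dots> = K * n ^ (?t - 1)" by (simp add: K_def)
        finally show "s * (card (verts H) choose ?t)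
            + m * 2 ^ card \<B> * (matching_size * ?t * card (verts H) ^ (?t - 1)) < m * card (link k H T)"
          unfolding H(2) using deg[OF T] by linarith
      qed
      note pop = this
      have "matching_size \<le> card (verts H)" using elim(2) H(2) by simp
      then obtain W where W: "W \<subseteq> verts H" "card W \<le> closure_size" "\<not> colourable W (edges H)"
        by (rule uncolourable_subset[OF H(1) _ pop])
      then show False using free_imp_locally_colourable[OF H(1,3) _ W(1,2)] elim(2) H(2) by simp
    qed
  qed
qed

section \<open>The host graphs and the lower bound\<close>

text \<open>The vertices are cut into consecutive blocks that contain each colour once; \<open>host_vertex u p\<close> is the
  vertex of colour \<open>p\<close> in block \<open>u\<close>.\<close>

definition host_vertex :: "nat \<Rightarrow> nat \<times> nat \<Rightarrow> nat" where
  "host_vertex u p = card palette * u + (m * snd p + fst p)"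

definition host_colour :: "nat \<Rightarrow> nat \<times> nat" where
  "host_colour v = (v mod m, v div m mod ((k - l) * l))"

definition host :: "nat \<Rightarrow> nat hypergraph" where
  "host n = ({..<n}, {e \<in> nsets {..<n} k.
     \<forall>T T' p. card T = l \<longrightarrow> card T' = k - l \<longrightarrow> T \<inter> T' = {} \<longrightarrow> e = T \<union> T' \<longrightarrow> (\<forall>v\<in>T. host_colour v = p) \<longrightarrow>
       ahead m (fst p) (leader (k - l) (image_mset host_colour (mset_set T'))) \<in> {1..s}})"

lemma verts_host [simp]: "verts (host n) = {..<n}"
  by (simp add: host_def)

lemma k_graph_host: "k_graph k (host n)"
  by (auto simp: host_def k_graph_def)

lemma host_colour_palette: "host_colour v \<in> palette"
  using m_pos l_pos codim_pos by (simp add: host_colour_def)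

lemma colourable_host: "colourable (verts (host n)) (edges (host n))"
  unfolding colourable_def
proof (intro exI[of _ host_colour] conjI)
  show "host_colour ` verts (host n) \<subseteq> palette" using host_colour_palette by blast
  show "admissible host_colour {e \<in> edges (host n). e \<subseteq> verts (host n)}"
    by (simp add: admissible_def host_def)
qed

lemma host_vertex_offset_less: "p \<in> palette \<Longrightarrow> m * snd p + fst p < card palette"
proof -
  assume "p \<in> palette"
  then have "fst p < m" "Suc (snd p) \<le> (k - l) * l" by auto
  then have "m * snd p + fst p < m * Suc (snd p)" by simp
  also have "\<dots> \<le> m * ((k - l) * l)" using \<open>Suc (snd p) \<le> (k - l) * l\<close> by (rule mult_le_mono2)
  finally show "m * snd p + fst p < card palette" by simp
qed

lemma host_vertex_div: "p \<in> palette \<Longrightarrow> host_vertex u p div card palette = u"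
  using host_vertex_offset_less palette_pos unfolding host_vertex_def by (metis add.right_neutral div_less div_mult_self4 less_not_refl2)

lemma host_colour_host_vertex: "p \<in> palette \<Longrightarrow> host_colour (host_vertex u p) = p"
proof -
  assume p: "p \<in> palette"
  have v: "host_vertex u p = m * ((k - l) * l * u + snd p) + fst p"
    by (simp add: host_vertex_def algebra_simps)
  have "host_vertex u p mod m = fst p" "host_vertex u p div m = (k - l) * l * u + snd p"
    unfolding v using p by auto
  then show "host_colour (host_vertex u p) = p" using p by (auto simp: host_colour_def prod_eq_iff)
qed

lemma host_vertex_less:
  assumes "p \<in> palette" "u < n div card palette"
  shows "host_vertex u p < n"
proof -
  have "host_vertex u p < card palette * Suc u" using host_vertex_offset_less[OF assms(1)] by (simp add: host_vertex_def)
  also have "\<dots> \<le> card palette * (n div card palette)" using assms(2) by (intro mult_le_mono2) simp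
  also have "\<dots> \<le> n" by simp
  finally show ?thesis .
qed

text \<open>A \<open>t\<close>-set of blocks disjoint from \<open>T\<close> and a colour sequence of length \<open>t\<close> determine a set of \<open>t\<close>
  vertices, one in each block. Blocks and colours can be chosen independently and can be read off
  from the set, so distinct choices give distinct sets. The sets with two vertices in one block are
  asymptotically negligible.\<close>

lemma count_coloured_sets:
  assumes G: "G \<subseteq> words palette t"
    and S: "finite \<S>" "\<And>X \<eta>. X \<subseteq> {..<n} \<Longrightarrow> card X = t \<Longrightarrow> X \<inter> T = {} \<Longrightarrow> \<eta> \<in> G \<Longrightarrow>
      image_mset host_colour (mset_set X) = mset \<eta> \<Longrightarrow> X \<in> \<S>"
    and T: "finite T" "card T = l"
  shows "((n div card palette - l) choose t) * card G \<le> card \<S>"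
proof -
  let ?q = "card palette"
  define Bk where "Bk = {..<n div ?q} - (\<lambda>v. v div ?q) ` T"
  define f where "f = (\<lambda>B \<eta> i. host_vertex (sorted_list_of_set B ! i) (\<eta> ! i))"
  define \<phi> where "\<phi> = (\<lambda>(B, \<eta>). f B \<eta> ` {..<t})"
  have finG: "finite G" using G finite_words finite_palette finite_subset by metis
  have nthB: "(\<lambda>i. sorted_list_of_set B ! i) ` {..<t} = B" "inj_on (\<lambda>i. sorted_list_of_set B ! i) {..<t}"
    if "B \<in> nsets Bk t" for B
  proof -
    have B: "finite B" "card B = t" using that by (auto simp: nsets_def)
    then have len: "length (sorted_list_of_set B) = t" by simp
    show "(\<lambda>i. sorted_list_of_set B ! i) ` {..<t} = B"
      using B(1) len by (metis atLeast_upt list.set_map map_nth set_sorted_list_of_set)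
    show "inj_on (\<lambda>i. sorted_list_of_set B ! i) {..<t}"
      using len by (simp add: inj_on_nth)
  qed
  have f_div: "f B \<eta> i div ?q = sorted_list_of_set B ! i" and f_col: "host_colour (f B \<eta> i) = \<eta> ! i"
    if "\<eta> \<in> G" "i < t" for B \<eta> i
  proof -
    have "set \<eta> \<subseteq> palette" "length \<eta> = t" using subsetD[OF G that(1)] by (simp_all add: words_def)
    then have "\<eta> ! i \<in> palette" using nth_mem that(2) by blast
    then show "f B \<eta> i div ?q = sorted_list_of_set B ! i" "host_colour (f B \<eta> i) = \<eta> ! i"
      unfolding f_def by (simp_all only: host_vertex_div host_colour_host_vertex)
  qed
  have "inj_on \<phi> (nsets Bk t \<times> G)"
  proof (rule inj_onI, clarify)
    fix B \<eta> B' \<eta>'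
    assume B: "B \<in> nsets Bk t" "B' \<in> nsets Bk t" and eta: "\<eta> \<in> G" "\<eta>' \<in> G"
      and eq: "\<phi> (B, \<eta>) = \<phi> (B', \<eta>')"
    have blocks: "(\<lambda>v. v div ?q) ` \<phi> (B, \<eta>) = B" if "B \<in> nsets Bk t" "\<eta> \<in> G" for B \<eta>
    proof -
      have "(\<lambda>v. v div ?q) ` \<phi> (B, \<eta>) = (\<lambda>i. sorted_list_of_set B ! i) ` {..<t}"
        unfolding \<phi>_def using f_div[OF that(2)] by (simp add: image_image del: card_cartesian_product)
      then show ?thesis using nthB(1)[OF that(1)] by simp
    qed
    have BB: "B = B'" using blocks[OF B(1) eta(1)] blocks[OF B(2) eta(2)] eq by simp
    have "\<eta> ! i = \<eta>' ! i" if "i < t" for i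
    proof -
      have "f B \<eta> i \<in> \<phi> (B', \<eta>')" using eq that by (auto simp: \<phi>_def)
      then obtain j where j: "j < t" "f B \<eta> i = f B' \<eta>' j" by (auto simp: \<phi>_def)
      then have "sorted_list_of_set B ! i = sorted_list_of_set B ! j"
        using f_div[OF eta(1) that, of B] f_div[OF eta(2) j(1), of B'] BB by simp
      then have "i = j" using nthB(2)[OF B(1)] that j(1) by (auto simp: inj_on_def)
      then show ?thesis using j(2) f_col[OF eta(1) that, of B] f_col[OF eta(2) j(1), of B'] by simp
    qed
    moreover have "length \<eta> = t" "length \<eta>' = t" using eta G by (auto simp: words_def)
    ultimately show "B = B' \<and> \<eta> = \<eta>'" using BB by (simp add: nth_equalityI)
  qed
  moreover have "\<phi> ` (nsets Bk t \<times> G) \<subseteq> \<S>"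
  proof clarify
    fix B \<eta> assume B: "B \<in> nsets Bk t" and eta: "\<eta> \<in> G"
    have inj: "inj_on (f B \<eta>) {..<t}"
    proof (rule inj_onI)
      fix i j assume ij: "i \<in> {..<t}" "j \<in> {..<t}" "f B \<eta> i = f B \<eta> j"
      then have "sorted_list_of_set B ! i = sorted_list_of_set B ! j"
        using f_div[OF eta, of i B] f_div[OF eta, of j B] by simp
      then show "i = j" using nthB(2)[OF B] ij(1,2) by (auto simp: inj_on_def)
    qed
    have mem: "f B \<eta> i < n" "f B \<eta> i \<notin> T" if "i < t" for i
    proof -
      have "sorted_list_of_set B ! i \<in> Bk" using nthB(1)[OF B] B that by (auto simp: nsets_def)
      then have u: "sorted_list_of_set B ! i < n div ?q" "sorted_list_of_set B ! i \<notin> (\<lambda>v. v div ?q) ` T"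
        by (auto simp: Bk_def)
      have "set \<eta> \<subseteq> palette" "length \<eta> = t" using subsetD[OF G eta] by (simp_all add: words_def)
      then have "\<eta> ! i \<in> palette" using nth_mem that by blast
      from host_vertex_less[OF this u(1)] show "f B \<eta> i < n" by (simp add: f_def)
      show "f B \<eta> i \<notin> T" using u(2) f_div[OF eta that, of B] by (metis image_eqI)
    qed
    have leneta: "length \<eta> = t" using G eta by (auto simp: words_def)
    show "\<phi> (B, \<eta>) \<in> \<S>"
    proof (rule S(2)[OF _ _ _ eta])
      show "\<phi> (B, \<eta>) \<subseteq> {..<n}" "\<phi> (B, \<eta>) \<inter> T = {}" using mem by (auto simp: \<phi>_def)
      show "card (\<phi> (B, \<eta>)) = t" using inj by (simp add: \<phi>_def card_image)
      have "image_mset host_colour (mset_set (\<phi> (B, \<eta>))) = image_mset (\<lambda>i. host_colour (f B \<eta> i)) (mset_set {..<t})"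
        using inj by (simp add: \<phi>_def image_mset_mset_set[symmetric] multiset.map_comp comp_def)
      also have "\<dots> = image_mset (\<lambda>i. \<eta> ! i) (mset_set {..<t})"
        using f_col[OF eta] by (intro image_mset_cong) simp
      also have "\<dots> = mset (map ((!) \<eta>) [0..<t])" by (simp add: lessThan_atLeast0)
      also have "map ((!) \<eta>) [0..<t] = \<eta>" using leneta map_nth by blast
      finally show "image_mset host_colour (mset_set (\<phi> (B, \<eta>))) = mset \<eta>" .
    qed
  qed
  ultimately have "card (nsets Bk t \<times> G) \<le> card \<S>" using S(1) by (intro card_inj_on_le)
  moreover have "n div ?q - l \<le> card Bk"
  proof -
    have "card ((\<lambda>v. v div ?q) ` T) \<le> l" using T card_image_le by metis
    moreover have "card {..<n div ?q} - card ((\<lambda>v. v div ?q) ` T) \<le> card Bk"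
      unfolding Bk_def using T(1) by (intro diff_card_le_card_Diff) simp
    ultimately show ?thesis by simp
  qed
  ultimately show ?thesis
    by (simp add: card_cartesian_product) (meson binomial_right_mono le_trans mult_le_mono1)
qed

text \<open>The \<open>s\<close> positions on the arc of \<open>x\<close> each have probability \<open>1 / m\<close> of being the leader.\<close>

lemma monochromatic_card:
  assumes x: "x < m"
  shows "s * card palette ^ (k - l)
    \<le> m * card {\<eta> \<in> words palette (k - l). ahead m x (leader (k - l) (mset \<eta>)) \<in> {1..s}}"
proof -
  let ?t = "k - l"
  let ?Y = "{y. y < m \<and> ahead m x y \<in> {1..s}}"
  let ?W = "\<lambda>y. {\<eta> \<in> words palette ?t. leader ?t (mset \<eta>) = y}"
  have finW: "finite (words palette ?t)" by (intro finite_words finite_palette)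
  have "s * card palette ^ ?t \<le> card ?Y * card palette ^ ?t"
    using card_ahead_ge[OF s_less x] by (rule mult_le_mono1)
  also have "\<dots> = (\<Sum>y\<in>?Y. card (?W y) * m)"
    using card_leader_eq[OF codim_pos, of _ m l] by simp
  also have "\<dots> = m * card (\<Union>y\<in>?Y. ?W y)"
    using finW by (subst card_UN_disjoint) (auto simp: sum_distrib_left mult.commute)
  also have "\<dots> \<le> m * card {\<eta> \<in> words palette ?t. ahead m x (leader ?t (mset \<eta>)) \<in> {1..s}}"
    using finW by (intro mult_le_mono2 card_mono) auto
  finally show ?thesis .
qed

text \<open>Bernoulli's inequality: avoiding \<open>l\<close> of the \<open>m * (k - l) * l\<close> colours \<open>k - l\<close> times has
  probability at least \<open>1 - 1 / m\<close>, and \<open>s \<le> m - 1\<close>.\<close>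

lemma non_monochromatic_card:
  assumes "card C \<le> l" "C \<subseteq> palette"
  shows "s * card palette ^ (k - l) \<le> m * card (words (palette - C) (k - l))"
proof -
  let ?t = "k - l" and ?q = "card palette"
  have finC: "finite C" using assms(2) finite_palette finite_subset by blast
  have q: "real ?q = real m * (real ?t * real l)" by simp
  have qpos: "real ?q > 0" using palette_pos by linarith
  have "real l / real ?q = 1 / (real m * real ?t)"
    unfolding q using l_pos by simp
  moreover have "1 / (real m * real ?t) \<le> 1"
  proof -
    have "1 \<le> m * ?t" using m_pos codim_pos by (simp add: Suc_le_eq)
    then have "1 \<le> real m * real ?t" by (metis of_nat_1 of_nat_le_iff of_nat_mult)
    then show ?thesis by (auto simp only: divide_le_eq_1)
  qed
  ultimately have lq: "real l / real ?q = 1 / (real m * real ?t)" "real l / real ?q \<le> 1" by simp_all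
  have cancel: "x * (1 + y * - (1 / (x * y))) = x - 1" if "x \<noteq> 0" "y \<noteq> 0" for x y :: real
    using that by (simp add: field_simps)
  have clear: "(1 + - (x / y)) * y = y - x" if "y > 0" for x y :: real
    using that by (simp add: field_simps)
  have "real s \<le> real m - 1" using s_less by linarith
  also have "\<dots> = real m * (1 + real ?t * - (real l / real ?q))"
    unfolding lq(1) using m_pos codim_pos by (intro cancel[symmetric]) simp_all
  also have "real m * (1 + real ?t * - (real l / real ?q)) \<le> real m * (1 + - (real l / real ?q)) ^ ?t"
    using lq(2) by (intro mult_left_mono Bernoulli_inequality) auto
  finally have "real s * real ?q ^ ?t \<le> real m * (1 + - (real l / real ?q)) ^ ?t * real ?q ^ ?t"
    by (intro mult_right_mono) auto
  also have "\<dots> = real m * ((1 + - (real l / real ?q)) * real ?q) ^ ?t"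
    by (simp only: power_mult_distrib mult.assoc)
  also have "(1 + - (real l / real ?q)) * real ?q = real ?q - real l"
    using clear qpos by blast
  also have "real m * (real ?q - real l) ^ ?t \<le> real m * real (card (palette - C)) ^ ?t"
  proof (intro mult_left_mono power_mono)
    have "?q - card C = card (palette - C)" using assms(2) finC by (simp add: card_Diff_subset del: card_cartesian_product)
    then show "real ?q - real l \<le> real (card (palette - C))" using assms(1) by linarith
    have "real l \<le> real ?q" using lq(2) qpos by (auto simp only: divide_le_eq_1)
    then show "0 \<le> real ?q - real l" by (simp only: diff_ge_0_iff_ge)
  qed simp
  finally have "real s * real ?q ^ ?t \<le> real m * real (card (palette - C)) ^ ?t" .
  then have "real (s * ?q ^ ?t) \<le> real (m * card (palette - C) ^ ?t)" by (simp del: card_cartesian_product)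
  then show ?thesis using card_words[of "palette - C" ?t] finite_palette by (simp only: of_nat_le_iff finite_Diff)
qed

text \<open>Let \<open>T2\<close> be a monochromatic \<open>l\<close>-set in \<open>T \<union> X\<close>; it meets \<open>T\<close>. If \<open>T\<close> is monochromatic, both have the
  same colour, and removing \<open>l\<close> copies of it from the colours of \<open>T \<union> X\<close> shows that the complement of
  \<open>T2\<close> has the same colours as \<open>X\<close>, hence the same leader. If \<open>T\<close> is not monochromatic, \<open>T2\<close> meets
  \<open>X\<close> as well, so \<open>X\<close> shares a colour with \<open>T\<close>.\<close>

lemma degree_host:
  assumes T: "T \<in> nsets {..<n} l"
  shows "s * card palette ^ (k - l) * ((n div card palette - l) choose (k - l)) \<le> m * degree k (host n) T"
proof -
  let ?t = "k - l"
  have T': "T \<subseteq> {..<n}" "finite T" "card T = l" using T by (auto simp: nsets_def)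
  have fin: "finite (link k (host n) T)"
    by (auto simp: link_def finite_imp_finite_nsets)
  have meet: "T2 \<inter> T \<noteq> {}" if "T \<union> X = T2 \<union> X2" "card X = ?t" "card T2 = l" "T \<inter> X = {}" "finite X" for T2 X X2 :: "nat set"
  proof
    assume "T2 \<inter> T = {}"
    then have "T2 \<subseteq> X" using that(1) by blast
    then have "l \<le> ?t" using that by (metis card_mono)
    then show False using majority l_less by simp
  qed
  have in_link: "X \<in> link k (host n) T"
    if X: "X \<subseteq> {..<n}" "card X = ?t" "X \<inter> T = {}"
      and ok: "\<And>T2 X2 p. card T2 = l \<Longrightarrow> card X2 = ?t \<Longrightarrow> T2 \<inter> X2 = {} \<Longrightarrow> T \<union> X = T2 \<union> X2 \<Longrightarrow>
        \<forall>v\<in>T2. host_colour v = p \<Longrightarrow> ahead m (fst p) (leader ?t (image_mset host_colour (mset_set X2))) \<in> {1..s}"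
    for X
  proof -
    have finX: "finite X" using X(1) finite_subset by blast
    then have "card (T \<union> X) = k" using T' X l_less by (subst card_Un_disjoint) auto
    then have "T \<union> X \<in> nsets {..<n} k" using T' X(1) finX by (simp add: nsets_def)
    with ok have "T \<union> X \<in> edges (host n)" unfolding host_def snd_conv by blast
    then show ?thesis using T' X finX by (auto simp: link_def nsets_def)
  qed
  obtain G where G: "G \<subseteq> words palette ?t" "s * card palette ^ ?t \<le> m * card G"
    and GL: "\<And>X \<eta>. X \<subseteq> {..<n} \<Longrightarrow> card X = ?t \<Longrightarrow> X \<inter> T = {} \<Longrightarrow> \<eta> \<in> G \<Longrightarrow>
      image_mset host_colour (mset_set X) = mset \<eta> \<Longrightarrow> X \<in> link k (host n) T"
  proof (cases "\<exists>p. \<forall>v\<in>T. host_colour v = p")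
    case True
    then obtain p where p: "\<And>v. v \<in> T \<Longrightarrow> host_colour v = p" by blast
    obtain v where "v \<in> T" using T'(3) l_pos by fastforce
    then have "fst p < m" using p host_colour_palette[of v] by auto
    show thesis
    proof (rule that[OF _ monochromatic_card[OF \<open>fst p < m\<close>]])
      fix X \<eta>
      assume X: "X \<subseteq> {..<n}" "card X = ?t" "X \<inter> T = {}"
        and eta: "\<eta> \<in> {\<eta> \<in> words palette ?t. ahead m (fst p) (leader ?t (mset \<eta>)) \<in> {1..s}}"
        and col: "image_mset host_colour (mset_set X) = mset \<eta>"
      show "X \<in> link k (host n) T"
      proof (rule in_link[OF X])
        fix T2 X2 p2
        assume T2: "card T2 = l" "card X2 = ?t" "T2 \<inter> X2 = {}" "T \<union> X = T2 \<union> X2" "\<forall>v\<in>T2. host_colour v = p2"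
        have finX: "finite X" using X(1) finite_subset by blast
        then have fin2: "finite T2" "finite X2" using T'(2) T2(4) by (metis finite_Un)+
        obtain v where "v \<in> T2" "v \<in> T" using meet[OF T2(4) X(2) T2(1) _ finX] X(3) by blast
        then have p2: "p2 = p" using p T2(5) by force
        have const: "image_mset host_colour (mset_set S) = replicate_mset l p"
          if "finite S" "card S = l" "\<forall>v\<in>S. host_colour v = p" for S
        proof -
          have "image_mset host_colour (mset_set S) = image_mset (\<lambda>_. p) (mset_set S)"
            using that by (intro image_mset_cong) simp
          then show ?thesis using that by (simp add: image_mset_const_eq)
        qed
        have "image_mset host_colour (mset_set (T \<union> X)) = replicate_mset l p + image_mset host_colour (mset_set X)"
          using T' X(3) finX p const[of T] by (simp add: mset_set_Union Int_commute)
        moreover have "image_mset host_colour (mset_set (T2 \<union> X2)) = replicate_mset l p + image_mset host_colour (mset_set X2)"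
          using T2 fin2 p2 const[of T2] by (simp add: mset_set_Union)
        ultimately have "image_mset host_colour (mset_set X2) = mset \<eta>" using T2(4) col by simp
        then show "ahead m (fst p2) (leader ?t (image_mset host_colour (mset_set X2))) \<in> {1..s}"
          using eta p2 by simp
      qed
    qed auto
  next
    case False
    have "card (host_colour ` T) \<le> l" using T' card_image_le by metis
    moreover have "host_colour ` T \<subseteq> palette" using host_colour_palette by blast
    ultimately have ge: "s * card palette ^ ?t \<le> m * card (words (palette - host_colour ` T) ?t)"
      by (rule non_monochromatic_card)
    show thesis
    proof (rule that[OF _ ge])
      show "words (palette - host_colour ` T) ?t \<subseteq> words palette ?t" by (auto simp: words_def)
      fix X \<eta>
      assume X: "X \<subseteq> {..<n}" "card X = ?t" "X \<inter> T = {}"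
        and eta: "\<eta> \<in> words (palette - host_colour ` T) ?t"
        and col: "image_mset host_colour (mset_set X) = mset \<eta>"
      have finX: "finite X" using X(1) finite_subset by blast
      have "host_colour ` X = set \<eta>" using arg_cong[OF col, of set_mset] finX by simp
      then have disj: "host_colour ` X \<inter> host_colour ` T = {}" using eta by (auto simp: words_def)
      show "X \<in> link k (host n) T"
      proof (rule in_link[OF X])
        fix T2 X2 p
        assume T2: "card T2 = l" "card X2 = ?t" "T2 \<inter> X2 = {}" "T \<union> X = T2 \<union> X2" "\<forall>v\<in>T2. host_colour v = p"
        obtain v where v: "v \<in> T2" "v \<in> T" using meet[OF T2(4) X(2) T2(1) _ finX] X(3) by blast
        have "T2 \<inter> X \<noteq> {}"
        proof
          assume "T2 \<inter> X = {}"
          then have "T2 \<subseteq> T" using T2(4) by blast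
          then have "T2 = T" using T2(1) T' card_subset_eq by metis
          then show False using False T2(5) by blast
        qed
        then obtain w where "w \<in> T2" "w \<in> X" by blast
        then have "host_colour w = host_colour v" using T2(5) v(1) by simp
        then show "ahead m (fst p) (leader ?t (image_mset host_colour (mset_set X2))) \<in> {1..s}"
          using disj v(2) \<open>w \<in> X\<close> by (metis IntI empty_iff imageI)
      qed
    qed
  qed
  have "((n div card palette - l) choose ?t) * card G \<le> degree k (host n) T"
    unfolding degree_link using G(1) fin GL T'(2,3) by (rule count_coloured_sets)
  then have "m * (((n div card palette - l) choose ?t) * card G) \<le> m * degree k (host n) T"
    by (rule mult_le_mono2)
  moreover have "s * card palette ^ ?t * ((n div card palette - l) choose ?t)
      \<le> m * card G * ((n div card palette - l) choose ?t)"
    using G(2) by (rule mult_le_mono1)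
  ultimately show ?thesis by (simp only: ac_simps)
qed

section \<open>The density\<close>

lemma ex_degree_bounds:
  assumes "l \<le> n"
  obtains H :: "nat hypergraph" where "k_graph k H" "card (verts H) = n" "family_free obstructions H"
    "ex_degree k l n obstructions = min_degree k l H"
    and "min_degree k l (host n) \<le> ex_degree k l n obstructions"
proof -
  let ?S = "{min_degree k l H | H :: nat hypergraph.
      k_graph k H \<and> card (verts H) = n \<and> family_free obstructions H}"
  have "?S \<subseteq> {..2 ^ n}"
  proof
    fix d assume "d \<in> ?S"
    then obtain H :: "nat hypergraph" where d: "d = min_degree k l H"
      and H: "k_graph k H" "n = card (verts H)" by blast
    then have fin: "finite (verts H)" by (simp add: k_graph_def)
    obtain T where T: "T \<in> nsets (verts H) l" "min_degree k l H = degree k H T"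
      using min_degree_attained[OF fin] assms H(2) by metis
    have "card T = l" using T(1) by (simp add: nsets_def)
    then have "link k H T \<subseteq> nsets (verts H) (k - l)" by (auto simp: link_def nsets_def)
    then have "degree k H T \<le> card (nsets (verts H) (k - l))"
      unfolding degree_link using fin by (intro card_mono finite_imp_finite_nsets)
    then show "d \<in> {..2 ^ n}"
      using d H(2) T(2) binomial_le_pow2[of "card (verts H)" "k - l"] by simp
  qed
  then have fin: "finite ?S" by (rule finite_subset) simp
  have host: "min_degree k l (host n) \<in> ?S"
    using k_graph_host colourable_imp_free[OF colourable_host] by (intro CollectI exI[of _ "host n"]) simp
  then have "Max ?S \<in> ?S" using fin by (intro Max_in) auto
  moreover have "min_degree k l (host n) \<le> Max ?S" using fin host by (rule Max_ge)
  ultimately show thesis using that unfolding ex_degree_def by blast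
qed

theorem ex_ratio_tendsto: "ex_ratio k l obstructions \<longlonglongrightarrow> real s / real m"
proof (rule order_tendstoI)
  fix a assume a: "a < real s / real m"
  let ?q = "card palette" and ?t = "k - l"
  have "(\<lambda>n. real s / real m * (real (?q ^ ?t * ((n div ?q - l) choose ?t)) / real ((n - l) choose ?t)))
      \<longlonglongrightarrow> real s / real m * 1"
    by (intro tendsto_mult tendsto_const block_binomial_ratio palette_pos)
  then have "\<forall>\<^sub>F n in sequentially.
      a < real s / real m * (real (?q ^ ?t * ((n div ?q - l) choose ?t)) / real ((n - l) choose ?t))"
    using a by (intro order_tendstoD(1)) auto
  then show "\<forall>\<^sub>F n in sequentially. a < ex_ratio k l obstructions n"
    using eventually_ge_at_top[of l]
  proof eventually_elim
    case (elim n)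
    obtain T where T: "T \<in> nsets {..<n} l" "min_degree k l (host n) = degree k (host n) T"
      using min_degree_attained[of "host n" l k] elim(2) by auto
    have "s * (?q ^ ?t * ((n div ?q - l) choose ?t)) \<le> m * min_degree k l (host n)"
      using degree_host[OF T(1)] T(2) by (simp only: ac_simps)
    also have "\<dots> \<le> m * ex_degree k l n obstructions"
      by (rule ex_degree_bounds[OF elim(2)]) (rule mult_le_mono2)
    finally have "real s * real (?q ^ ?t * ((n div ?q - l) choose ?t)) \<le> real m * real (ex_degree k l n obstructions)"
      by (metis of_nat_le_iff of_nat_mult)
    then have "real s / real m * real (?q ^ ?t * ((n div ?q - l) choose ?t)) \<le> real (ex_degree k l n obstructions)"
      using m_pos by (simp add: field_simps del: card_cartesian_product)
    then have "real s / real m * real (?q ^ ?t * ((n div ?q - l) choose ?t)) / real ((n - l) choose ?t)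
        \<le> ex_ratio k l obstructions n"
      unfolding ex_ratio_def by (rule divide_right_mono) simp
    then show ?case using elim(1) by (simp only: times_divide_eq_right)
  qed
next
  fix a assume a: "real s / real m < a"
  then have "0 < a - real s / real m" by simp
  from eventually_min_degree_less[OF this] eventually_ge_at_top[of k]
  show "\<forall>\<^sub>F n in sequentially. ex_ratio k l obstructions n < a"
  proof eventually_elim
    case (elim n)
    then have "l \<le> n" using l_less by simp
    obtain H :: "nat hypergraph" where H: "k_graph k H" "card (verts H) = n" "family_free obstructions H"
      "ex_degree k l n obstructions = min_degree k l H"
      by (rule ex_degree_bounds[OF \<open>l \<le> n\<close>])
    have "real (min_degree k l H) < a * real ((n - l) choose (k - l))"
      using elim(1)[rule_format, OF H(1-3)] by simp
    moreover have "0 < (n - l) choose (k - l)" using elim(2) by (simp add: zero_less_binomial_iff)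
    ultimately show ?case unfolding ex_ratio_def H(4) by (simp add: divide_less_eq)
  qed
qed

end

theorem theorem1p1:
  fixes k l :: nat and \<alpha> :: real
  assumes "k \<ge> 3" and "real k / 2 < real l" and "l < k"
    and "\<alpha> \<in> \<rat>" and "0 \<le> \<alpha>" and "\<alpha> < 1"
  shows "\<exists>\<F> :: nat hypergraph set.
           finite \<F> \<and> \<F> \<noteq> {} \<and> (\<forall>F\<in>\<F>. k_graph k F \<and> edges F \<noteq> {}) \<and>
           convergent (ex_ratio k l \<F>) \<and> turan_density k l \<F> = \<alpha>"
proof -
  obtain s m :: nat where sm: "m \<noteq> 0" "\<bar>\<alpha>\<bar> = real s / real m"
    using Rats_abs_nat_div_natE[OF assms(4)] by metis
  then have alpha: "\<alpha> = real s / real m" using assms(5) by simp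
  interpret circular_pattern k l m s
  proof
    show "l < k" by (rule assms(3))
    show "k < 2 * l" using assms(2) by linarith
    show "s < m" using assms(6) alpha sm(1) by simp
  qed
  have "ex_ratio k l obstructions \<longlonglongrightarrow> \<alpha>" using ex_ratio_tendsto alpha by simp
  then have "convergent (ex_ratio k l obstructions)" "turan_density k l obstructions = \<alpha>"
    by (auto simp: turan_density_def convergent_def limI)
  then show ?thesis using finite_obstructions obstructions_nonempty obstructions_k_graphs by blast
qed

end
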